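(* Let $s\in\{4,5\}$ and let $n$ be an integer with $n>2$. Let $C\subset\mathbb{S}^{n-1}$ be a spherical $s$-distance $t$-design with $t\geq 2s-2$. Then $\langle x,y\rangle$ is a rational number for all $x,y\in C$.
   Context: $\mathbb{S}^{n-1}$ is the unit sphere in $\mathbb{R}^n$ with the standard inner product $\langle\cdot,\cdot\rangle$. A finite set $C\subset\mathbb{S}^{n-1}$ is a spherical $t$-design if $\frac{1}{\mu(\mathbb{S}^{n-1})}\int_{\mathbb{S}^{n-1}} f\,d\mu=\frac{1}{|C|}\sum_{x\in C}f(x)$ for every polynomial $f$ in $n$ variables of degree at most $t$, where $\mu$ is the surface measure. $C$ is $s$-distance if the set $A(C)=\{\langle x,y\rangle: x,y\in C,\ x\neq y\}$ has exactly $s$ elements. *)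

theory Defs
  imports "HOL-Analysis.Analysis"
begin

(* The surface measure on the unit sphere, via polar coordinates: up to the factor n it is the
   image of Lebesgue measure on the punctured unit ball under the radial projection. The factor
   makes the total mass n * vol(ball), the surface area; see emeasure_sphere_surface below for
   the usual formula. *)
definition sphere_surface :: "(real ^ 'n) measure" where
  "sphere_surface =
     scale_measure (of_nat CARD('n))
       (distr (restrict_space lborel (ball 0 1 - {0})) (restrict_space borel (sphere 0 1))
         (\<lambda>x. x /\<^sub>R norm x))"

(* The functions on R^n given by a real polynomial in n variables of total degree at most t;
   an exponent vector e stands for the monomial prod_i x_i^(e_i). *)
definition polynomial_fun_le :: "nat \<Rightarrow> (real ^ 'n \<Rightarrow> real) \<Rightarrow> bool" where
  "polynomial_fun_le t f \<longleftrightarrow>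
     (\<exists>c :: ('n \<Rightarrow> nat) \<Rightarrow> real.
        f = (\<lambda>x. \<Sum>e | (\<Sum>i\<in>UNIV. e i) \<le> t. c e * (\<Prod>i\<in>UNIV. (x $ i) ^ e i)))"

definition spherical_design :: "nat \<Rightarrow> (real ^ 'n) set \<Rightarrow> bool" where
  "spherical_design t C \<longleftrightarrow>
     finite C \<and> C \<subseteq> sphere 0 1 \<and>
     (\<forall>f. polynomial_fun_le t f \<longrightarrow>
        1 / measure sphere_surface (sphere (0 :: real ^ 'n) 1) * (\<integral>x. f x \<partial>sphere_surface)
        = 1 / real (card C) * (\<Sum>x\<in>C. f x))"

definition inner_products :: "(real ^ 'n) set \<Rightarrow> real set" where
  "inner_products C = {x \<bullet> y | x y. x \<in> C \<and> y \<in> C \<and> x \<noteq> y}"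

definition distance_set :: "nat \<Rightarrow> (real ^ 'n) set \<Rightarrow> bool" where
  "distance_set s C \<longleftrightarrow> finite C \<and> C \<subseteq> sphere 0 1 \<and> card (inner_products C) = s"

lemma finite_exponents: "finite {e :: 'n::finite \<Rightarrow> nat. (\<Sum>i\<in>UNIV. e i) \<le> t}"
proof (rule finite_subset)
  show "{e :: 'n \<Rightarrow> nat. (\<Sum>i\<in>UNIV. e i) \<le> t} \<subseteq> UNIV \<rightarrow>\<^sub>E {..t}"
  proof
    fix e :: "'n \<Rightarrow> nat" assume "e \<in> {e. (\<Sum>i\<in>UNIV. e i) \<le> t}"
    moreover have "e i \<le> sum e UNIV" for i by (rule member_le_sum) auto
    ultimately have "e i \<le> t" for i by (metis mem_Collect_eq order_trans)
    then show "e \<in> UNIV \<rightarrow>\<^sub>E {..t}" by auto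
  qed
  show "finite ((UNIV :: 'n set) \<rightarrow>\<^sub>E {..t})" by (rule finite_PiE) auto
qed

lemma space_sphere_surface: "space sphere_surface = sphere (0 :: real ^ 'n) 1"
  by (simp add: sphere_surface_def space_scale_measure space_restrict_space)

lemma sets_sphere_surface:
  "sets sphere_surface = sets (restrict_space borel (sphere (0 :: real ^ 'n) 1))"
  by (simp add: sphere_surface_def)

lemma radial_projection_measurable:
  "(\<lambda>x. x /\<^sub>R norm x) \<in>
     restrict_space lborel (ball 0 1 - {0 :: real ^ 'n}) \<rightarrow>\<^sub>M restrict_space borel (sphere 0 1)"
  by (rule measurable_restrict_space2)
     (auto simp: space_restrict_space intro!: measurable_restrict_space1)

lemma emeasure_sphere_surface:
  fixes A :: "(real ^ 'n) set"
  assumes "A \<in> sets borel" "A \<subseteq> sphere 0 1"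
  shows "emeasure sphere_surface A =
    of_nat CARD('n) * emeasure lborel {r *\<^sub>R x | r x. 0 < r \<and> r < 1 \<and> x \<in> A}"
proof -
  let ?p = "\<lambda>x :: real ^ 'n. x /\<^sub>R norm x"
  let ?M = "restrict_space lborel (ball 0 1 - {0 :: real ^ 'n})"
  have "?p -` A \<inter> space ?M = {r *\<^sub>R x | r x. 0 < r \<and> r < 1 \<and> x \<in> A}" (is "?L = ?R")
  proof
    show "?L \<subseteq> ?R"
    proof
      fix x assume "x \<in> ?L"
      then have "x = norm x *\<^sub>R ?p x \<and> 0 < norm x \<and> norm x < 1 \<and> ?p x \<in> A"
        by (auto simp: space_restrict_space)
      then show "x \<in> ?R" by blast
    qed
    show "?R \<subseteq> ?L"
      using assms(2) by (auto simp: space_restrict_space)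
  qed
  moreover have "?R \<subseteq> ball 0 1 - {0}"
    using assms(2) by auto
  moreover have "A \<in> sets (restrict_space borel (sphere (0 :: real ^ 'n) 1))"
    using assms by (auto simp: sets_restrict_space_iff)
  ultimately show ?thesis
    by (simp add: sphere_surface_def emeasure_distr[OF radial_projection_measurable]
        emeasure_restrict_space)
qed

lemma emeasure_sphere_surface_UNIV:
  "emeasure sphere_surface (sphere (0 :: real ^ 'n) 1) =
    of_nat CARD('n) * emeasure lborel (ball (0 :: real ^ 'n) 1)"
proof -
  have "{r *\<^sub>R x | r x. 0 < r \<and> r < 1 \<and> x \<in> sphere 0 1} = ball 0 1 - {0 :: real ^ 'n}"
  proof (intro equalityI subsetI)
    fix x :: "real ^ 'n" assume "x \<in> ball 0 1 - {0}"
    then have "x = norm x *\<^sub>R (x /\<^sub>R norm x) \<and> 0 < norm x \<and> norm x < 1 \<and> x /\<^sub>R norm x \<in> sphere 0 1"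
      by auto
    then show "x \<in> {r *\<^sub>R x | r x. 0 < r \<and> r < 1 \<and> x \<in> sphere 0 1}" by blast
  qed auto
  moreover have "emeasure lborel (ball 0 1 - {0 :: real ^ 'n}) = emeasure lborel (ball (0 :: real ^ 'n) 1)"
    by (rule emeasure_Diff_null_set) auto
  ultimately show ?thesis
    by (subst emeasure_sphere_surface) auto
qed

end

theory Submission
  imports Defs
begin

text \<open>
  The projections \<open>E\<^sub>0, \<dots>, E\<^sub>s\<^sub>-\<^sub>1\<close> onto harmonic polynomials of degree \<open>j < s\<close>, restricted to
  \<open>C\<close>, together with \<open>E\<^sub>s = I - E\<^sub>0 - \<dots> - E\<^sub>s\<^sub>-\<^sub>1\<close> are orthogonal idempotents; let \<open>m\<^sub>j\<close> be their ranks.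
  By dual orthogonality, \<open>\<Sum>\<^sub>j E\<^sub>j / m\<^sub>j\<close> has rational entries, so interpolation in this matrix
  shows that \<open>E\<^sub>j\<close> is rational as soon as no other idempotent has rank \<open>m\<^sub>j\<close>; this takes
  the place of Galois conjugation. For \<open>n > 2\<close> the ranks with \<open>j < s\<close> are distinct, so either \<open>E\<^sub>1\<close>
  is rational and we are done, or \<open>m\<^sub>s = n\<close> and \<open>E\<^sub>2\<close>, \<open>E\<^sub>3\<close> are rational. In the latter case an
  irrational inner product \<open>a\<close> satisfies \<open>a\<^sup>2 = 3 / (n + 2)\<close>, a zero of the degree 3 Gegenbauer
  polynomial, and \<open>-a\<close> also occurs because \<open>C\<close> is balanced. For \<open>s = 4\<close>
  this contradicts the exactness of the quadrature formula in degree 6. For \<open>s = 5\<close> it determines the annihilator polynomial in terms of \<open>n\<close>, and with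
  it \<open>|C|\<close>, which never equals \<open>m\<^sub>0 + \<dots> + m\<^sub>4 + n\<close>.
\<close>

section \<open>Power sums of spherical designs\<close>

lemma borel_measurable_orthogonal_transformation:
  fixes f :: "'a::euclidean_space \<Rightarrow> 'a"
  assumes "orthogonal_transformation f"
  shows "f \<in> borel_measurable borel"
  using orthogonal_transformation_linear[OF assms]
  by (intro borel_measurable_continuous_onI linear_continuous_on)
    (rule linear_conv_bounded_linear[THEN iffD1])

text \<open>The library proves that linear maps act on Lebesgue measure through their determinant only
  for well-ordered index types. Every finite type is in bijection with the well-ordered type below,
  which removes this restriction.\<close>

typedef 'n rank = "{..<CARD('n::finite)}"
  by (rule exI[of _ 0]) (simp add: card_gt_0_iff)

instance rank :: (finite) finite
proof
  show "finite (UNIV :: 'a rank set)"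
    unfolding type_definition.univ[OF type_definition_rank] by simp
qed

instantiation rank :: (finite) linorder
begin

definition "a \<le> b \<longleftrightarrow> Rep_rank a \<le> Rep_rank b"
definition "a < b \<longleftrightarrow> Rep_rank a < Rep_rank b"

instance
  by standard (auto simp: less_eq_rank_def less_rank_def Rep_rank_inject)

end

instance rank :: (finite) wellorder
proof -
  have "wf {(x :: 'a rank, y). x < y}"
    by (auto simp: trancl_def tranclp_less intro!: finite_acyclic_wf acyclicI)
  thus "OFCLASS('a rank, wellorder_class)"
    by (rule wf_wellorderI) intro_classes
qed

text \<open>Boxes pull back to boxes with permuted sides, and Lebesgue measure is determined by its
  values on boxes.\<close>

lemma lborel_distr_reindex:
  fixes \<sigma> :: "'m::finite \<Rightarrow> 'n::finite"
  assumes \<sigma>: "bij \<sigma>"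
  shows "distr lborel borel (\<lambda>x :: real ^ 'n. \<chi> i. x $ \<sigma> i) = (lborel :: (real ^ 'm) measure)"
    (is "distr lborel borel ?f = _")
proof (rule sym, rule lborel_eqI)
  have meas: "?f \<in> borel_measurable borel"
    by (intro borel_measurable_continuous_onI continuous_intros)
  fix l u :: "real ^ 'm"
  assume lu: "\<And>b. b \<in> Basis \<Longrightarrow> l \<bullet> b \<le> u \<bullet> b"
  then have lu': "l $ i \<le> u $ i" for i
    using lu[of "axis i 1"] by (simp add: inner_axis axis_in_Basis_iff)
  let ?l = "\<chi> i. l $ inv \<sigma> i" and ?u = "\<chi> i. u $ inv \<sigma> i"
  have [simp]: "inv \<sigma> (\<sigma> i) = i" "\<sigma> (inv \<sigma> j) = j" for i j
    using \<sigma> by (auto simp: bij_is_inj bij_is_surj surj_f_inv_f)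
  have "?f -` box l u = box ?l ?u"
  proof (intro set_eqI)
    fix x :: "real ^ 'n"
    have "(\<forall>i. P i (x $ \<sigma> i)) \<longleftrightarrow> (\<forall>j. P (inv \<sigma> j) (x $ j))" for P
      by (metis \<open>\<And>i. inv \<sigma> (\<sigma> i) = i\<close> \<open>\<And>j. \<sigma> (inv \<sigma> j) = j\<close>)
    from this[of "\<lambda>i t. l $ i < t \<and> t < u $ i"]
    show "x \<in> ?f -` box l u \<longleftrightarrow> x \<in> box ?l ?u"
      by (simp add: mem_box_cart)
  qed
  then have "emeasure (distr lborel borel ?f) (box l u) = emeasure lborel (box ?l ?u)"
    using meas by (simp add: emeasure_distr)
  also have "\<dots> = (\<Prod>b\<in>Basis. (?u - ?l) \<bullet> b)"
    by (rule emeasure_lborel_box) (use lu' in \<open>auto simp: Basis_vec_def inner_axis\<close>)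
  also have "(\<Prod>b\<in>Basis. (?u - ?l) \<bullet> b) = (\<Prod>i\<in>UNIV. u $ inv \<sigma> i - l $ inv \<sigma> i)"
    by (simp add: Basis_vec_def UNION_singleton_eq_range prod.reindex inj_on_def axis_eq_axis inner_axis)
  also have "\<dots> = (\<Prod>i\<in>UNIV. u $ i - l $ i)"
    by (rule prod.reindex_bij_betw[of "inv \<sigma>" UNIV UNIV "\<lambda>i. u $ i - l $ i"])
      (use \<sigma> bij_imp_bij_inv in blast)
  also have "\<dots> = (\<Prod>b\<in>Basis. (u - l) \<bullet> b)"
    by (simp add: Basis_vec_def UNION_singleton_eq_range prod.reindex inj_on_def axis_eq_axis inner_axis)
  finally show "emeasure (distr lborel borel ?f) (box l u) = (\<Prod>b\<in>Basis. (u - l) \<bullet> b)" .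
qed simp

text \<open>The preimage of a box is its image under the inverse map, which is again orthogonal and
  so preserves volume.\<close>

lemma lborel_distr_orthogonal_wellorder:
  fixes f :: "real ^ 'n::{finite,wellorder} \<Rightarrow> real ^ 'n::_"
  assumes f: "orthogonal_transformation f"
  shows "distr lborel borel f = lborel"
proof (rule sym, rule lborel_eqI)
  have meas: "f \<in> borel_measurable borel"
    using f by (rule borel_measurable_orthogonal_transformation)
  have inv: "orthogonal_transformation (inv f)"
    using f by (rule orthogonal_transformation_inv)
  fix l u :: "real ^ 'n::_"
  assume lu: "\<And>b. b \<in> Basis \<Longrightarrow> l \<bullet> b \<le> u \<bullet> b"
  have vim: "f -` box l u = inv f ` box l u"
    using orthogonal_transformation_bij[OF f] by (simp add: bij_vimage_eq_inv_image)
  have "inv f ` box l u \<in> lmeasurable"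
    by (rule measurable_linear_image[OF orthogonal_transformation_linear[OF inv]]) simp
  have b: "f -` box l u \<in> sets borel"
    using measurable_sets[OF meas, of "box l u"] by simp
  have "emeasure (distr lborel borel f) (box l u) = emeasure lborel (f -` box l u)"
    using meas by (simp add: emeasure_distr)
  also have "\<dots> = emeasure lebesgue (inv f ` box l u)"
    using b by (simp add: vim)
  also have "\<dots> = ennreal (measure lebesgue (inv f ` box l u))"
    using \<open>inv f ` box l u \<in> lmeasurable\<close> by (rule emeasure_eq_measure2)
  also have "measure lebesgue (inv f ` box l u) = measure lebesgue (box l u)"
    using inv by (intro measure_orthogonal_image) auto
  also have "ennreal (measure lebesgue (box l u)) = (\<Prod>b\<in>Basis. (u - l) \<bullet> b)"
    using lu by (simp add: measure_lborel_box)
  finally show "emeasure (distr lborel borel f) (box l u) = (\<Prod>b\<in>Basis. (u - l) \<bullet> b)" .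
qed simp

text \<open>Conjugation by the relabelling isometries \<open>\<phi>\<close> and
  \<open>\<psi>\<close> moves \<open>f\<close> to a well-ordered index type.\<close>

lemma lborel_distr_orthogonal:
  fixes f :: "real ^ 'n \<Rightarrow> real ^ 'n"
  assumes f: "orthogonal_transformation f"
  shows "distr lborel borel f = lborel"
proof -
  have "card (UNIV :: 'n rank set) = CARD('n)"
    using type_definition.card[OF type_definition_rank] by simp
  then obtain \<sigma> :: "'n rank \<Rightarrow> 'n" where \<sigma>: "bij \<sigma>"
    using finite_same_card_bij[of "UNIV :: 'n rank set" "UNIV :: 'n set"] by auto
  then have inv[simp]: "inv \<sigma> (\<sigma> i) = i" "\<sigma> (inv \<sigma> j) = j" for i j
    by (auto simp: bij_is_inj bij_is_surj surj_f_inv_f)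
  define \<phi> where "\<phi> = (\<lambda>x :: real ^ 'n. \<chi> i. x $ \<sigma> i)"
  define \<psi> where "\<psi> = (\<lambda>x :: real ^ 'n rank. \<chi> i. x $ inv \<sigma> i)"
  have \<phi>: "distr lborel borel \<phi> = lborel" "\<phi> \<in> borel_measurable borel"
    unfolding \<phi>_def by (rule lborel_distr_reindex[OF \<sigma>],
      intro borel_measurable_continuous_onI continuous_intros)
  have \<psi>: "distr lborel borel \<psi> = lborel" "\<psi> \<in> borel_measurable borel"
    unfolding \<psi>_def by (rule lborel_distr_reindex[OF bij_imp_bij_inv[OF \<sigma>]],
      intro borel_measurable_continuous_onI continuous_intros)
  have \<psi>\<phi>: "\<psi> (\<phi> x) = x" for x
    by (simp add: \<phi>_def \<psi>_def vec_eq_iff)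
  have "linear \<phi>" "linear \<psi>"
    by (auto simp: \<phi>_def \<psi>_def linear_iff vec_eq_iff)
  have "bij_betw (inv \<sigma>) UNIV UNIV"
    using \<sigma> bij_imp_bij_inv by blast
  have inner: "\<phi> x \<bullet> \<phi> y = x \<bullet> y" "\<psi> x' \<bullet> \<psi> y' = x' \<bullet> y'" for x y x' y'
    unfolding inner_vec_def \<phi>_def \<psi>_def
    using sum.reindex_bij_betw[OF \<sigma>, of "\<lambda>i. x $ i \<bullet> y $ i"]
      sum.reindex_bij_betw[OF \<open>bij_betw (inv \<sigma>) UNIV UNIV\<close>, of "\<lambda>i. x' $ i \<bullet> y' $ i"]
    by simp_all
  have f': "orthogonal_transformation (\<phi> \<circ> f \<circ> \<psi>)"
    using f \<open>linear \<phi>\<close> \<open>linear \<psi>\<close>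
    by (auto simp: orthogonal_transformation_def inner intro!: linear_compose)
  have meas: "f \<in> borel_measurable borel" "\<phi> \<circ> f \<circ> \<psi> \<in> borel_measurable borel"
    using f f' by (auto intro: borel_measurable_orthogonal_transformation)
  have "distr lborel borel f = distr lborel borel (\<psi> \<circ> (\<phi> \<circ> f \<circ> \<psi>) \<circ> \<phi>)"
    by (simp add: o_def \<psi>\<phi>)
  also have "\<dots> = distr (distr (distr lborel borel \<phi>) borel (\<phi> \<circ> f \<circ> \<psi>)) borel \<psi>"
    using \<phi>(2) \<psi>(2) meas by (simp add: distr_distr comp_assoc measurable_comp)
  also have "\<dots> = lborel"
    by (simp only: \<phi>(1) \<psi>(1) lborel_distr_orthogonal_wellorder[OF f'])
  finally show ?thesis .
qed

section \<open>Orthogonal invariance of the surface measure\<close>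

lemma orthogonal_measurable_sphere_surface:
  fixes f :: "real ^ 'n \<Rightarrow> real ^ 'n"
  assumes f: "orthogonal_transformation f"
  shows "f \<in> sphere_surface \<rightarrow>\<^sub>M sphere_surface"
proof -
  have "f \<in> borel_measurable borel"
    using f by (rule borel_measurable_orthogonal_transformation)
  then have "f \<in> restrict_space borel (sphere 0 1) \<rightarrow>\<^sub>M restrict_space borel (sphere 0 1)"
    using f by (intro measurable_restrict_space2)
      (auto simp: space_restrict_space orthogonal_transformation_norm intro!: measurable_restrict_space1)
  then show ?thesis
    using measurable_cong_sets[OF sets_sphere_surface sets_sphere_surface] by blast
qed

text \<open>The surface measure of \<open>A\<close> is the dimension times the volume of the cone
  over \<open>A\<close>. An orthogonal map commutes with scaling and keeps norms, so the cone over a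
  preimage is the preimage of the cone.\<close>

lemma sphere_surface_distr_orthogonal:
  fixes f :: "real ^ 'n \<Rightarrow> real ^ 'n"
  assumes f: "orthogonal_transformation f"
  shows "distr sphere_surface sphere_surface f = sphere_surface"
proof (rule measure_eqI)
  fix A assume "A \<in> sets (distr sphere_surface sphere_surface f)"
  then have "A \<in> sets sphere_surface" by simp
  then have A: "A \<in> sets borel" "A \<subseteq> sphere 0 1"
    by (auto simp: sets_sphere_surface sets_restrict_space_iff)
  have meas: "f \<in> borel_measurable borel"
    using f by (rule borel_measurable_orthogonal_transformation)
  let ?cone = "\<lambda>A. {r *\<^sub>R x | r x. 0 < r \<and> r < 1 \<and> x \<in> A} :: (real ^ 'n) set"
  let ?B = "f -` A \<inter> sphere 0 1"
  have nf: "norm (f x) = norm x" for x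
    using f by (rule orthogonal_transformation_norm)
  have fA: "f -` A \<inter> sphere 0 1 = f -` A"
    using A(2) nf by (auto simp: subset_iff)
  have B: "?B \<in> sets borel" "?B \<subseteq> sphere 0 1"
    using measurable_sets[OF meas A(1)] fA by auto
  \<comment> \<open>This second description of the cone gives its measurability and its
    compatibility with \<open>f\<close>.\<close>
  have cone_eq: "?cone A = {x \<in> ball 0 1 - {0}. x /\<^sub>R norm x \<in> A}" if "A \<subseteq> sphere 0 1" for A
  proof
    show "?cone A \<subseteq> {x \<in> ball 0 1 - {0}. x /\<^sub>R norm x \<in> A}"
      using that by auto
    show "{x \<in> ball 0 1 - {0}. x /\<^sub>R norm x \<in> A} \<subseteq> ?cone A"
    proof
      fix x assume "x \<in> {x \<in> ball 0 1 - {0}. x /\<^sub>R norm x \<in> A}"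
      then have "x = norm x *\<^sub>R (x /\<^sub>R norm x) \<and> 0 < norm x \<and> norm x < 1 \<and> x /\<^sub>R norm x \<in> A"
        by auto
      then show "x \<in> ?cone A" by blast
    qed
  qed
  have "{x \<in> ball 0 1 - {0}. x /\<^sub>R norm x \<in> A} \<in> sets (borel :: (real ^ 'n) measure)"
    using A(1) by measurable
  then have coneA: "?cone A \<in> sets borel" by (simp only: cone_eq[OF A(2)])
  have lin: "f (r *\<^sub>R x) = r *\<^sub>R f x" for r x
    using f by (rule orthogonal_transformation_scaleR)
  have f0: "f x = 0 \<longleftrightarrow> x = 0" for x
    using nf[of x] by (metis norm_eq_zero)
  have "?cone ?B = f -` ?cone A"
    unfolding cone_eq[OF A(2)] cone_eq[OF B(2)]
    by (auto simp: nf f0 simp flip: lin)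
  then have "emeasure lborel (?cone ?B) = emeasure (distr lborel borel f) (?cone A)"
    using coneA meas by (simp add: emeasure_distr)
  then have "emeasure sphere_surface ?B = emeasure sphere_surface A"
    unfolding emeasure_sphere_surface[OF A] emeasure_sphere_surface[OF B]
    by (simp add: lborel_distr_orthogonal[OF f])
  then show "emeasure (distr sphere_surface sphere_surface f) A = emeasure sphere_surface A"
    using orthogonal_measurable_sphere_surface[OF f] \<open>A \<in> sets sphere_surface\<close>
    by (simp add: emeasure_distr space_sphere_surface)
qed simp

text \<open>Some orthogonal map takes \<open>v\<close> to \<open>w\<close>, and the surface measure
  is invariant under it.\<close>

lemma integral_inner_power_sphere_surface:
  fixes v w :: "real ^ 'n"
  assumes "norm v = norm w"
  shows "(\<integral>z. (v \<bullet> z) ^ m \<partial>sphere_surface) = (\<integral>z. (w \<bullet> z) ^ m \<partial>sphere_surface)"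
proof -
  obtain f where f: "orthogonal_transformation f" "f v = w"
    using orthogonal_transformation_exists[OF assms] by blast
  have "(\<lambda>z. (w \<bullet> z) ^ m) \<in> borel_measurable (restrict_space borel (sphere 0 1))"
    by (rule measurable_restrict_space1) simp
  then have "(\<lambda>z. (w \<bullet> z) ^ m) \<in> borel_measurable sphere_surface"
    using measurable_cong_sets[OF sets_sphere_surface refl] by blast
  then have "(\<integral>z. (w \<bullet> z) ^ m \<partial>distr sphere_surface sphere_surface f)
      = (\<integral>z. (w \<bullet> f z) ^ m \<partial>sphere_surface)"
    by (rule integral_distr[OF orthogonal_measurable_sphere_surface[OF f(1)]])
  moreover have "w \<bullet> f z = v \<bullet> z" for z
    using f by (metis orthogonal_transformation_def)
  ultimately show ?thesis
    by (simp add: sphere_surface_distr_orthogonal[OF f(1)])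
qed

section \<open>Polynomial functions and power sums of designs\<close>

lemma polynomial_fun_le_sum:
  assumes "finite I" "\<And>i. i \<in> I \<Longrightarrow> polynomial_fun_le t (f i)"
  shows "polynomial_fun_le t (\<lambda>x. \<Sum>i\<in>I. a i * f i x)"
proof -
  from assms(2) obtain c where c: "\<And>i. i \<in> I \<Longrightarrow>
      f i = (\<lambda>x. \<Sum>e | (\<Sum>i\<in>UNIV. e i) \<le> t. c i e * (\<Prod>i\<in>UNIV. (x $ i) ^ e i))"
    unfolding polynomial_fun_le_def using bchoice[of I "\<lambda>i c. f i =
      (\<lambda>x. \<Sum>e | (\<Sum>i\<in>UNIV. e i) \<le> t. c e * (\<Prod>i\<in>UNIV. (x $ i) ^ e i))"] by blast
  show ?thesis
    unfolding polynomial_fun_le_def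
  proof (intro exI ext)
    fix x
    have "(\<Sum>i\<in>I. a i * f i x) =
      (\<Sum>i\<in>I. \<Sum>e | (\<Sum>i\<in>UNIV. e i) \<le> t. a i * c i e * (\<Prod>i\<in>UNIV. (x $ i) ^ e i))"
      by (simp add: c sum_distrib_left mult.assoc)
    also have "\<dots> = (\<Sum>e | (\<Sum>i\<in>UNIV. e i) \<le> t. \<Sum>i\<in>I. a i * c i e * (\<Prod>i\<in>UNIV. (x $ i) ^ e i))"
      by (rule sum.swap)
    finally show "(\<Sum>i\<in>I. a i * f i x) =
      (\<Sum>e | (\<Sum>i\<in>UNIV. e i) \<le> t. (\<Sum>i\<in>I. a i * c i e) * (\<Prod>i\<in>UNIV. (x $ i) ^ e i))"
      by (simp add: sum_distrib_right)
  qed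
qed

lemma polynomial_fun_le_mult_nth:
  fixes k :: "'n::finite"
  assumes "polynomial_fun_le t f"
  shows "polynomial_fun_le (Suc t) (\<lambda>x. x $ k * f x)"
proof -
  obtain c where c: "f = (\<lambda>x. \<Sum>e | (\<Sum>i\<in>UNIV. e i) \<le> t. c e * (\<Prod>i\<in>UNIV. (x $ i) ^ e i))"
    using assms unfolding polynomial_fun_le_def by blast
  define up where "up = (\<lambda>e :: 'n \<Rightarrow> nat. e(k := Suc (e k)))"
  \<comment> \<open>Coefficients are shifted by one in direction \<open>k\<close>. Exponents with
    \<open>e k = 0\<close> are not in the image of \<open>up\<close>; the value 0 there also keeps
    the truncated subtraction harmless.\<close>
  define c' where "c' = (\<lambda>e. if 0 < e k then c (e(k := e k - 1)) else 0)"
  have sum_upd: "(\<Sum>i\<in>UNIV. (e(k := m)) i) = m + (\<Sum>i\<in>UNIV - {k}. e i)" for e :: "'n \<Rightarrow> nat" and m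
    by (subst sum.remove[of _ k]) (auto intro!: sum.cong)
  have sum_split: "(\<Sum>i\<in>UNIV. e i) = e k + (\<Sum>i\<in>UNIV - {k}. e i)" for e :: "'n \<Rightarrow> nat"
    by (rule sum.remove) auto
  have img: "up ` {e. (\<Sum>i\<in>UNIV. e i) \<le> t} = {e. (\<Sum>i\<in>UNIV. e i) \<le> Suc t \<and> 0 < e k}"
  proof (intro equalityI subsetI)
    fix e assume "e \<in> {e. (\<Sum>i\<in>UNIV. e i) \<le> Suc t \<and> 0 < e k}"
    then have e: "(\<Sum>i\<in>UNIV. e i) \<le> Suc t" "0 < e k" by auto
    then have "e = up (e(k := e k - 1))" by (auto simp: up_def)
    moreover have "e(k := e k - 1) \<in> {e. (\<Sum>i\<in>UNIV. e i) \<le> t}"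
      using e sum_split[of e] by (simp add: sum_upd del: fun_upd_apply)
    ultimately show "e \<in> up ` {e. (\<Sum>i\<in>UNIV. e i) \<le> t}" by blast
  next
    fix e assume "e \<in> up ` {e. (\<Sum>i\<in>UNIV. e i) \<le> t}"
    then obtain d where d: "e = up d" "(\<Sum>i\<in>UNIV. d i) \<le> t" by auto
    then show "e \<in> {e. (\<Sum>i\<in>UNIV. e i) \<le> Suc t \<and> 0 < e k}"
      using sum_split[of d] sum_upd[of d "Suc (d k)"] by (simp add: up_def)
  qed
  have inj: "inj_on up X" for X
  proof (rule inj_onI)
    fix d e assume eq: "up d = up e"
    show "d = e"
    proof
      fix i
      from eq have "up d i = up e i" by simp
      then show "d i = e i" by (cases "i = k") (simp_all add: up_def)
    qed
  qed
  have "(\<Sum>e | (\<Sum>i\<in>UNIV. e i) \<le> Suc t. c' e * (\<Prod>i\<in>UNIV. (x $ i) ^ e i))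
      = x $ k * f x" for x
  proof -
    have "(\<Sum>e | (\<Sum>i\<in>UNIV. e i) \<le> Suc t. c' e * (\<Prod>i\<in>UNIV. (x $ i) ^ e i))
      = (\<Sum>e | (\<Sum>i\<in>UNIV. e i) \<le> Suc t \<and> 0 < e k. c' e * (\<Prod>i\<in>UNIV. (x $ i) ^ e i))"
      by (rule sum.mono_neutral_right) (auto simp: finite_exponents c'_def)
    also have "\<dots> = (\<Sum>e | (\<Sum>i\<in>UNIV. e i) \<le> t. c' (up e) * (\<Prod>i\<in>UNIV. (x $ i) ^ up e i))"
      unfolding img[symmetric] by (simp add: sum.reindex[OF inj])
    also have "\<dots> = (\<Sum>e | (\<Sum>i\<in>UNIV. e i) \<le> t. x $ k * (c e * (\<Prod>i\<in>UNIV. (x $ i) ^ e i)))"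
    proof (rule sum.cong[OF refl])
      fix e
      have "(\<Prod>i\<in>UNIV. (x $ i) ^ up e i) = x $ k * (\<Prod>i\<in>UNIV. (x $ i) ^ e i)"
        by (subst (1 2) prod.remove[of _ k]) (auto simp: up_def intro!: prod.cong)
      then show "c' (up e) * (\<Prod>i\<in>UNIV. (x $ i) ^ up e i)
          = x $ k * (c e * (\<Prod>i\<in>UNIV. (x $ i) ^ e i))"
        by (simp add: c'_def up_def)
    qed
    finally show ?thesis by (simp add: c sum_distrib_left)
  qed
  then show ?thesis unfolding polynomial_fun_le_def by (intro exI[of _ c'] ext) simp
qed

lemma polynomial_fun_le_mono:
  fixes f :: "real ^ 'n \<Rightarrow> real"
  assumes "polynomial_fun_le t f" "t \<le> t'"
  shows "polynomial_fun_le t' f"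
proof -
  obtain c where c: "f = (\<lambda>x. \<Sum>e | (\<Sum>i\<in>UNIV. e i) \<le> t. c e * (\<Prod>i\<in>UNIV. (x $ i) ^ e i))"
    using assms unfolding polynomial_fun_le_def by blast
  let ?c = "\<lambda>e. if (\<Sum>i\<in>UNIV. e i) \<le> t then c e else 0"
  have "f = (\<lambda>x. \<Sum>e | (\<Sum>i\<in>UNIV. e i) \<le> t'. ?c e * (\<Prod>i\<in>UNIV. (x $ i) ^ e i))"
    unfolding c
    by (rule ext, rule sum.mono_neutral_cong_left) (use assms(2) in \<open>auto simp: finite_exponents\<close>)
  then show ?thesis unfolding polynomial_fun_le_def by (rule exI[of _ ?c])
qed

lemma polynomial_fun_le_inner_power:
  fixes v :: "real ^ 'n"
  shows "polynomial_fun_le m (\<lambda>z. (v \<bullet> z) ^ m)"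
proof (induction m)
  case 0
  have "{e :: 'n \<Rightarrow> nat. (\<Sum>i\<in>UNIV. e i) \<le> 0} = {\<lambda>_. 0}" by auto
  then show ?case
    unfolding polynomial_fun_le_def by (intro exI[of _ "\<lambda>_. 1"]) simp
next
  case (Suc m)
  have "polynomial_fun_le (Suc m) (\<lambda>z. \<Sum>i\<in>UNIV. v $ i * (z $ i * (v \<bullet> z) ^ m))"
    by (intro polynomial_fun_le_sum polynomial_fun_le_mult_nth Suc.IH) simp
  then show ?case
    by (simp add: inner_vec_def sum_distrib_right mult.assoc)
qed

text \<open>Both sides are \<open>card C\<close> times a normalised surface integral that depends on
  the norm alone. This is the only consequence of the design property used later.\<close>

lemma spherical_design_power_sum:
  fixes v w :: "real ^ 'n"
  assumes "spherical_design t C" "m \<le> t" "norm v = norm w"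
  shows "(\<Sum>z\<in>C. (v \<bullet> z) ^ m) = (\<Sum>z\<in>C. (w \<bullet> z) ^ m)"
proof (cases "C = {}")
  case False
  then have "card C \<noteq> 0" using assms(1) by (simp add: spherical_design_def)
  have "polynomial_fun_le t (\<lambda>z. (u \<bullet> z) ^ m)" for u :: "real ^ 'n"
    using polynomial_fun_le_inner_power assms(2) by (rule polynomial_fun_le_mono)
  then have "1 / measure sphere_surface (sphere (0 :: real ^ 'n) 1) *
      (\<integral>z. (u \<bullet> z) ^ m \<partial>sphere_surface) = 1 / real (card C) * (\<Sum>z\<in>C. (u \<bullet> z) ^ m)"
    for u :: "real ^ 'n"
    using assms(1) unfolding spherical_design_def by blast
  then have "1 / real (card C) * (\<Sum>z\<in>C. (v \<bullet> z) ^ m) = 1 / real (card C) * (\<Sum>z\<in>C. (w \<bullet> z) ^ m)"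
    by (metis integral_inner_power_sphere_surface[OF assms(3)])
  then show ?thesis using \<open>card C \<noteq> 0\<close> by simp
qed simp

section \<open>Moments\<close>

lemma coeff_pCons_numeral:
  "coeff (pCons a p) 1 = coeff p 0" "coeff (pCons a p) 2 = coeff p 1"
  "coeff (pCons a p) 3 = coeff p 2" "coeff (pCons a p) 4 = coeff p 3"
  by (simp_all add: eval_nat_numeral)

text \<open>The dimension enters as a real number \<open>n\<close> because it serves as a variable
  in rational identities. The design property is kept only in the form
  \<open>power_sum\<close>.\<close>

locale isotropic_code =
  fixes C :: "(real ^ 'n) set" and t :: nat and n :: real
  assumes dim: "n = real CARD('n)"
    and finite_C: "finite C"
    and C_nonempty: "C \<noteq> {}"
    and norm_C: "z \<in> C \<Longrightarrow> norm z = 1"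
    and power_sum: "m \<le> t \<Longrightarrow> norm v = norm w \<Longrightarrow> (\<Sum>z\<in>C. (v \<bullet> z) ^ m) = (\<Sum>z\<in>C. (w \<bullet> z) ^ m)"
begin

definition avg :: "(real ^ 'n \<Rightarrow> real) \<Rightarrow> real" where
  "avg f = (\<Sum>z\<in>C. f z) / real (card C)"

text \<open>The index \<open>undefined\<close> is an arbitrary choice: up to degree
  \<open>t\<close>, \<open>power_sum\<close> gives every unit vector the same moment.\<close>

definition moment :: "nat \<Rightarrow> real" where
  "moment m = avg (\<lambda>z. (axis undefined 1 \<bullet> z) ^ m)"

lemma card_C: "card C > 0"
  using finite_C C_nonempty by (simp add: card_gt_0_iff)

lemma avg_cong: "(\<And>z. z \<in> C \<Longrightarrow> f z = g z) \<Longrightarrow> avg f = avg g"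
  unfolding avg_def by (simp cong: sum.cong)

lemma avg_sum: "avg (\<lambda>z. \<Sum>i\<in>I. f i z) = (\<Sum>i\<in>I. avg (f i))"
  unfolding avg_def sum_divide_distrib[symmetric] by (subst sum.swap) (rule refl)

lemma avg_mult_left: "avg (\<lambda>z. c * f z) = c * avg f"
  by (simp add: avg_def sum_distrib_left)

lemma avg_const: "avg (\<lambda>z. c) = c"
  using card_C by (simp add: avg_def)

lemma avg_inner_power:
  assumes "m \<le> t"
  shows "avg (\<lambda>z. (v \<bullet> z) ^ m) = moment m * norm v ^ m"
proof -
  have "(\<Sum>z\<in>C. (v \<bullet> z) ^ m) = (\<Sum>z\<in>C. ((norm v *\<^sub>R axis undefined 1) \<bullet> z) ^ m)"
    by (rule power_sum[OF assms]) simp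
  also have "\<dots> = norm v ^ m * (\<Sum>z\<in>C. (axis undefined 1 \<bullet> z) ^ m)"
    by (simp add: power_mult_distrib sum_distrib_left)
  finally show ?thesis
    by (simp add: avg_def moment_def)
qed

text \<open>The average of the \<open>m\<close>-th power of \<open>(x + r y) . z\<close> is computed
  by the binomial theorem and by \<open>avg_inner_power\<close>. Comparing coefficients in
  \<open>r\<close> will give the mixed moments.\<close>

lemma polarised_moment:
  assumes "m \<le> t"
  shows "(\<Sum>j\<le>m. real (m choose j) * avg (\<lambda>z. (x \<bullet> z) ^ (m - j) * (y \<bullet> z) ^ j) * r ^ j)
      = moment m * norm (x + r *\<^sub>R y) ^ m"
proof -
  have "((x + r *\<^sub>R y) \<bullet> z) ^ m =
      (\<Sum>j\<le>m. (real (m choose j) * r ^ j) * ((x \<bullet> z) ^ (m - j) * (y \<bullet> z) ^ j))" for z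
  proof -
    have "((x + r *\<^sub>R y) \<bullet> z) ^ m = (r * (y \<bullet> z) + x \<bullet> z) ^ m"
      by (simp add: inner_add_left add.commute)
    also have "\<dots> = (\<Sum>j\<le>m. real (m choose j) * (r * (y \<bullet> z)) ^ j * (x \<bullet> z) ^ (m - j))"
      by (rule binomial_ring)
    finally show ?thesis
      by (simp add: power_mult_distrib mult_ac)
  qed
  then have "avg (\<lambda>z. ((x + r *\<^sub>R y) \<bullet> z) ^ m) =
      (\<Sum>j\<le>m. (real (m choose j) * r ^ j) * avg (\<lambda>z. (x \<bullet> z) ^ (m - j) * (y \<bullet> z) ^ j))"
    by (simp only: avg_sum avg_mult_left)
  then show ?thesis
    by (simp add: avg_inner_power[OF assms] mult_ac)
qed

text \<open>A unit vector and its negative have the same norm but opposite odd power sums.\<close>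

lemma moment_odd:
  assumes "odd m" "m \<le> t"
  shows "moment m = 0"
proof -
  let ?e = "axis undefined 1 :: real ^ 'n"
  have "avg (\<lambda>z. (- ?e \<bullet> z) ^ m) = - moment m"
    using assms(1) avg_mult_left[of "-1"] by (simp add: moment_def power_minus_odd)
  then show ?thesis
    using avg_inner_power[OF assms(2), of "- ?e"] by simp
qed

lemma mixed_moment_odd:
  assumes "odd m" "m \<le> t" "j \<le> m"
  shows "avg (\<lambda>z. (x \<bullet> z) ^ (m - j) * (y \<bullet> z) ^ j) = 0"
proof -
  define p where
    "p = (\<Sum>j\<le>m. monom (real (m choose j) * avg (\<lambda>z. (x \<bullet> z) ^ (m - j) * (y \<bullet> z) ^ j)) j)"
  have "poly p r = 0" for r
    using polarised_moment[OF assms(2), of x y r] moment_odd[OF assms(1,2)]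
    by (simp add: p_def poly_sum poly_monom)
  then have "p = 0"
    by (metis poly_all_0_iff_0)
  then have "coeff p j = 0" by simp
  then show ?thesis
    using assms(3) by (simp add: p_def coeff_sum)
qed

text \<open>The squared norm of \<open>x + r y\<close> is a quadratic polynomial in
  \<open>r\<close>; its \<open>k\<close>-th power is compared with \<open>polarised_moment\<close>
  coefficient by coefficient.\<close>

lemma mixed_moment_even:
  assumes "2 * k \<le> t" "j \<le> 2 * k"
  shows "real (2 * k choose j) * avg (\<lambda>z. (x \<bullet> z) ^ (2 * k - j) * (y \<bullet> z) ^ j)
    = moment (2 * k) * coeff ([:x \<bullet> x, 2 * (x \<bullet> y), y \<bullet> y:] ^ k) j"
proof -
  define p where "p = (\<Sum>j\<le>2 * k. monom (real (2 * k choose j) *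
    avg (\<lambda>z. (x \<bullet> z) ^ (2 * k - j) * (y \<bullet> z) ^ j)) j)"
  define q where "q = smult (moment (2 * k)) ([:x \<bullet> x, 2 * (x \<bullet> y), y \<bullet> y:] ^ k)"
  have "norm (x + r *\<^sub>R y) ^ (2 * k) = (x \<bullet> x + r * (2 * (x \<bullet> y) + r * (y \<bullet> y))) ^ k" for r
    unfolding power_mult power2_norm_eq_inner
    by (simp add: inner_add_left inner_add_right inner_commute[of y x] algebra_simps)
  then have "poly p = poly q"
    using polarised_moment[OF assms(1), of x y]
    by (intro ext) (simp add: p_def q_def poly_sum poly_monom)
  then have "coeff p j = coeff q j"
    by (simp add: poly_eq_poly_eq_iff)
  then show ?thesis
    using assms(2) by (simp add: p_def q_def coeff_sum)
qed

section \<open>Values of the even moments\<close>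

lemma moment_0: "moment 0 = 1"
  by (simp add: moment_def avg_const)

text \<open>On \<open>C\<close> the squared coordinates sum to 1. Inserting this sum into the
  average of the \<open>2 * k\<close>-th power of one coordinate gives the next even moment once,
  and \<open>n - 1\<close> times that moment divided by \<open>2 * k + 1\<close>.\<close>

lemma moment_Suc:
  assumes "2 * Suc k \<le> t"
  shows "moment (2 * Suc k) * (n + 2 * real k) = (2 * real k + 1) * moment (2 * k)"
proof -
  let ?e = "\<lambda>i :: 'n. axis i 1 :: real ^ 'n"
  let ?u = "undefined :: 'n"
  \<comment> \<open>For orthonormal vectors the quadratic in \<open>mixed_moment_even\<close> is
    \<open>1 + r^2\<close>.\<close>
  have coeff_02: "coeff ([:1, 0, 1 :: real:] ^ m) 0 = 1 \<and> coeff ([:1, 0, 1 :: real:] ^ m) 2 = real m" for m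
    by (induction m) (auto simp: numeral_2_eq_2)
  have off: "(2 * real k + 1) * avg (\<lambda>z. (?e ?u \<bullet> z) ^ (2 * k) * (?e i \<bullet> z) ^ 2) = moment (2 * Suc k)"
    if "i \<noteq> ?u" for i
  proof -
    have "real (2 * Suc k choose 2) = (2 * real k + 1) * real (Suc k)"
      by (simp add: choose_two algebra_simps)
    moreover have "?e ?u \<bullet> ?e ?u = 1" "?e ?u \<bullet> ?e i = 0" "?e i \<bullet> ?e i = 1"
      using that by (simp_all add: inner_axis_axis)
    ultimately have "((2 * real k + 1) * real (Suc k)) *
        avg (\<lambda>z. (?e ?u \<bullet> z) ^ (2 * k) * (?e i \<bullet> z) ^ 2) = moment (2 * Suc k) * real (Suc k)"
      using mixed_moment_even[OF assms, of 2 "?e ?u" "?e i"] coeff_02[of "Suc k"] by simp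
    then show ?thesis by simp
  qed
  have diag: "avg (\<lambda>z. (?e ?u \<bullet> z) ^ (2 * k) * (?e ?u \<bullet> z) ^ 2) = moment (2 * Suc k)"
    by (simp add: moment_def power_add[symmetric])
  have "moment (2 * k) = avg (\<lambda>z. \<Sum>i\<in>UNIV. (?e ?u \<bullet> z) ^ (2 * k) * (?e i \<bullet> z) ^ 2)"
    unfolding moment_def
  proof (rule avg_cong)
    fix z assume "z \<in> C"
    then have "(\<Sum>i\<in>UNIV. (?e i \<bullet> z) ^ 2) = 1"
      using norm_C[of z] by (simp add: inner_axis' norm_eq_1 inner_vec_def[of z z] power2_eq_square)
    then show "(?e ?u \<bullet> z) ^ (2 * k) = (\<Sum>i\<in>UNIV. (?e ?u \<bullet> z) ^ (2 * k) * (?e i \<bullet> z) ^ 2)"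
      by (simp flip: sum_distrib_left)
  qed
  also have "\<dots> = (\<Sum>i\<in>UNIV. avg (\<lambda>z. (?e ?u \<bullet> z) ^ (2 * k) * (?e i \<bullet> z) ^ 2))"
    by (rule avg_sum)
  also have "\<dots> = moment (2 * Suc k) +
      (\<Sum>i\<in>UNIV - {?u}. avg (\<lambda>z. (?e ?u \<bullet> z) ^ (2 * k) * (?e i \<bullet> z) ^ 2))"
    by (subst sum.remove[of _ ?u]) (simp_all only: diag finite iso_tuple_UNIV_I)
  also have "(2 * real k + 1) * \<dots> = (2 * real k + 1) * moment (2 * Suc k) +
      (\<Sum>i\<in>UNIV - {?u}. moment (2 * Suc k))"
    unfolding distrib_left sum_distrib_left by (intro arg_cong2[of _ _ _ _ "(+)"] sum.cong refl off) auto
  also have "\<dots> = moment (2 * Suc k) * (n + 2 * real k)"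
    by (simp add: card_Diff_singleton dim of_nat_diff Suc_leI card_gt_0_iff algebra_simps)
  finally show ?thesis by simp
qed

lemma moment_add_2:
  assumes "m + 2 \<le> t" "even m"
  shows "moment (m + 2) * (n + real m) = (real m + 1) * moment m"
  using assms moment_Suc[of "m div 2"] by (auto elim!: evenE)

lemma n_pos: "n > 0"
  by (simp add: dim card_gt_0_iff)

lemma moment_2: "2 \<le> t \<Longrightarrow> moment 2 = 1 / n"
  using moment_add_2[of 0] n_pos by (simp add: moment_0 field_simps numeral_2_eq_2)

lemma moment_4: "4 \<le> t \<Longrightarrow> moment 4 = 3 / (n * (n + 2))"
  using moment_add_2[of 2] moment_2 n_pos by (simp add: field_simps add_nonneg_eq_0_iff)

lemma moment_6: "6 \<le> t \<Longrightarrow> moment 6 = 15 / (n * (n + 2) * (n + 4))"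
  using moment_add_2[of 4] moment_4 n_pos by (simp add: field_simps add_nonneg_eq_0_iff)

lemma moment_8: "8 \<le> t \<Longrightarrow> moment 8 = 105 / (n * (n + 2) * (n + 4) * (n + 6))"
  using moment_add_2[of 6] moment_6 n_pos by (simp add: field_simps add_nonneg_eq_0_iff)

definition mixed_moment :: "real ^ 'n \<Rightarrow> real ^ 'n \<Rightarrow> nat \<Rightarrow> nat \<Rightarrow> real" where
  "mixed_moment x y a b = avg (\<lambda>z. (x \<bullet> z) ^ a * (y \<bullet> z) ^ b)"

text \<open>The values come from the coefficients of \<open>(1 + 2 u r + r^2)^k\<close>. The list
  suffices up to exchanging \<open>x\<close> and \<open>y\<close>.\<close>

lemma mixed_moment_eqs:
  assumes "x \<bullet> x = 1" "y \<bullet> y = 1" "x \<bullet> y = u" "mixed_moment x y = M"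
  shows "M 0 0 = 1"
    and "2 \<le> t \<Longrightarrow> M 0 2 = moment 2" "2 \<le> t \<Longrightarrow> M 1 1 = u * moment 2" "2 \<le> t \<Longrightarrow> M 2 0 = moment 2"
    and "4 \<le> t \<Longrightarrow> M 0 4 = moment 4" "4 \<le> t \<Longrightarrow> M 1 3 = u * moment 4"
      "4 \<le> t \<Longrightarrow> M 2 2 = (1 + 2 * u\<^sup>2) / 3 * moment 4"
    and "6 \<le> t \<Longrightarrow> M 2 4 = (1 + 4 * u\<^sup>2) / 5 * moment 6"
      "6 \<le> t \<Longrightarrow> M 3 3 = (3 * u + 2 * u ^ 3) / 5 * moment 6"
    and "8 \<le> t \<Longrightarrow> M 4 4 = (3 + 24 * u\<^sup>2 + 8 * u ^ 4) / 35 * moment 8"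
proof -
  have *: "2 * k \<le> t \<Longrightarrow> j \<le> 2 * k \<Longrightarrow> real (2 * k choose j) * M (2 * k - j) j
      = moment (2 * k) * coeff ([:1, 2 * u, 1:] ^ k) j" for k j
    using mixed_moment_even[of k j x y] by (simp add: assms(1-3) mixed_moment_def flip: assms(4))
  have ch: "(4 choose 2 :: nat) = 6" "(6 choose 2 :: nat) = 15" "(6 choose 3 :: nat) = 20"
    "(6 choose 4 :: nat) = 15" "(4 choose 3 :: nat) = 4" "(8 choose 4 :: nat) = 70"
    by (simp_all add: eval_nat_numeral)
  have pw2: "[:1, 2 * u, 1:] ^ 2 = [:1, 4 * u, 2 + 4 * u ^ 2, 4 * u, 1:]"
    by (simp add: power2_eq_square)
  have pw3: "[:1, 2 * u, 1:] ^ 3 =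
      [:1, 6 * u, 3 + 12 * u ^ 2, 12 * u + 8 * u ^ 3, 3 + 12 * u ^ 2, 6 * u, 1:]"
    by (simp add: power3_eq_cube power2_eq_square algebra_simps)
  have "[:1, 2 * u, 1:] ^ 4 = ([:1, 2 * u, 1:] ^ 2) ^ 2"
    by (simp flip: power_mult)
  then have pw4: "[:1, 2 * u, 1:] ^ 4 = [:1, 8 * u, 4 + 24 * u ^ 2, 24 * u + 32 * u ^ 3,
      6 + 48 * u ^ 2 + 16 * u ^ 4, 24 * u + 32 * u ^ 3, 4 + 24 * u ^ 2, 8 * u, 1:]"
    by (simp add: pw2) (simp add: power2_eq_square eval_nat_numeral algebra_simps)
  show "M 0 0 = 1" using *[of 0 0] by (simp add: moment_0)
  show "2 \<le> t \<Longrightarrow> M 0 2 = moment 2" "2 \<le> t \<Longrightarrow> M 1 1 = u * moment 2" "2 \<le> t \<Longrightarrow> M 2 0 = moment 2"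
    using *[of 1 0] *[of 1 1] *[of 1 2] by (simp_all add: coeff_pCons_numeral)
  show "4 \<le> t \<Longrightarrow> M 0 4 = moment 4" "4 \<le> t \<Longrightarrow> M 1 3 = u * moment 4"
      "4 \<le> t \<Longrightarrow> M 2 2 = (1 + 2 * u\<^sup>2) / 3 * moment 4"
    using *[of 2 2] *[of 2 3] *[of 2 4]
    by (simp_all add: pw2 coeff_pCons_numeral ch) (simp_all add: field_simps)
  show "6 \<le> t \<Longrightarrow> M 2 4 = (1 + 4 * u\<^sup>2) / 5 * moment 6"
      "6 \<le> t \<Longrightarrow> M 3 3 = (3 * u + 2 * u ^ 3) / 5 * moment 6"
    using *[of 3 3] *[of 3 4] by (simp_all add: pw3 coeff_pCons_numeral ch) (simp_all add: field_simps)
  show "8 \<le> t \<Longrightarrow> M 4 4 = (3 + 24 * u\<^sup>2 + 8 * u ^ 4) / 35 * moment 8"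
    using *[of 4 4] by (simp add: pw4 coeff_pCons_numeral ch) (simp add: field_simps)
qed

end

section \<open>Gegenbauer polynomials\<close>

text \<open>The Gegenbauer polynomials of the sphere in dimension \<open>n\<close>, scaled to be the
  reproducing kernels of the harmonic polynomials: the value at 1 is the dimension of the space of
  harmonic polynomials of degree \<open>j\<close>. Only \<open>j \<le> 4\<close> is meaningful.\<close>

definition gegenbauer :: "real \<Rightarrow> nat \<Rightarrow> real poly" where
  "gegenbauer n j =
    [[:1:],
     [:0, n:],
     smult ((n + 2) / 2) [:-1, 0, n:],
     smult (n * (n + 4) / 6) [:0, -3, 0, n + 2:],
     smult (n * (n + 6) / 24) [:3, 0, -6 * (n + 2), 0, (n + 2) * (n + 4):]] ! j"

lemma gegenbauer_simps:
  "gegenbauer n 0 = [:1:]"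
  "gegenbauer n 1 = [:0, n:]"
  "gegenbauer n 2 = smult ((n + 2) / 2) [:-1, 0, n:]"
  "gegenbauer n 3 = smult (n * (n + 4) / 6) [:0, -3, 0, n + 2:]"
  "gegenbauer n 4 = smult (n * (n + 6) / 24) [:3, 0, -6 * (n + 2), 0, (n + 2) * (n + 4):]"
  by (simp_all add: gegenbauer_def)

lemma le_4_cases:
  fixes j :: nat
  assumes "j \<le> 4"
  obtains "j = 0" | "j = 1" | "j = 2" | "j = 3" | "j = 4"
  using assms by linarith

lemma degree_gegenbauer: "j \<le> 4 \<Longrightarrow> n > 0 \<Longrightarrow> degree (gegenbauer n j) = j"
  by (erule le_4_cases) (simp_all add: gegenbauer_simps add_nonneg_eq_0_iff del: One_nat_def)

lemma gegenbauer_nonzero: "j \<le> 4 \<Longrightarrow> n > 0 \<Longrightarrow> gegenbauer n j \<noteq> 0"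
  by (erule le_4_cases) (simp_all add: gegenbauer_simps add_nonneg_eq_0_iff del: One_nat_def)

lemma coeff_gegenbauer_neq_0: "j \<le> 4 \<Longrightarrow> n > 0 \<Longrightarrow> coeff (gegenbauer n j) j \<noteq> 0"
  using leading_coeff_neq_0[OF gegenbauer_nonzero, of j n] by (simp add: degree_gegenbauer)

lemma poly_gegenbauer_1:
  "poly (gegenbauer n 0) 1 = 1"
  "poly (gegenbauer n 1) 1 = n"
  "poly (gegenbauer n 2) 1 = (n + 2) * (n - 1) / 2"
  "poly (gegenbauer n 3) 1 = n * (n + 4) * (n - 1) / 6"
  "poly (gegenbauer n 4) 1 = n * (n + 6) * (n\<^sup>2 - 1) / 24"
  by (simp_all add: gegenbauer_simps field_simps power2_eq_square del: One_nat_def)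

lemma poly_as_sum:
  fixes p :: "real poly"
  assumes "degree p \<le> d"
  shows "poly p x = (\<Sum>a\<le>d. coeff p a * x ^ a)"
proof -
  have "(\<Sum>a\<le>degree p. coeff p a * x ^ a) = (\<Sum>a\<le>d. coeff p a * x ^ a)"
    by (rule sum.mono_neutral_left) (use assms in \<open>auto simp: coeff_eq_0\<close>)
  then show ?thesis by (simp add: poly_altdef)
qed

lemma sum_atMost_numeral:
  "sum f {..0 :: nat} = f 0"
  "sum f {..1 :: nat} = f 0 + f 1"
  "sum f {..2 :: nat} = f 0 + f 1 + f 2"
  "sum f {..3 :: nat} = f 0 + f 1 + f 2 + f 3"
  "sum f {..4 :: nat} = f 0 + f 1 + f 2 + f 3 + f 4"
  for f :: "nat \<Rightarrow> 'a::comm_monoid_add"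
  by (simp_all add: eval_nat_numeral)

section \<open>Orthogonality of Gegenbauer polynomials over the code\<close>

context isotropic_code
begin

lemma avg_mult_poly:
  assumes "degree q \<le> j"
  shows "avg (\<lambda>z. f z * poly q (y \<bullet> z)) = (\<Sum>b\<le>j. coeff q b * avg (\<lambda>z. f z * (y \<bullet> z) ^ b))"
proof -
  have "f z * poly q (y \<bullet> z) = (\<Sum>b\<le>j. coeff q b * (f z * (y \<bullet> z) ^ b))" for z
    unfolding poly_as_sum[OF assms] sum_distrib_left by (simp add: mult_ac)
  then show ?thesis by (simp only: avg_sum avg_mult_left)
qed

text \<open>Multiplying by the leading coefficient makes the reproducing formula for the monomial of
  degree \<open>j\<close> free of divisions.\<close>

lemma avg_monomial_gegenbauer:
  assumes "a \<le> j" "j \<le> 4" "2 * j \<le> t" "x \<bullet> x = 1" "y \<bullet> y = 1"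
  shows "coeff (gegenbauer n j) j * avg (\<lambda>z. (x \<bullet> z) ^ a * poly (gegenbauer n j) (y \<bullet> z)) =
    (if a = j then poly (gegenbauer n j) (x \<bullet> y) else 0)"
proof -
  define M where "M = mixed_moment x y"
  define u where "u = x \<bullet> y"
  have exp: "avg (\<lambda>z. (x \<bullet> z) ^ a * poly (gegenbauer n j) (y \<bullet> z)) =
    (\<Sum>b\<le>j. coeff (gegenbauer n j) b * M a b)"
    unfolding M_def mixed_moment_def
    by (rule avg_mult_poly) (use assms n_pos in \<open>simp_all add: degree_gegenbauer\<close>)
  have odd: "M a b = 0" if "odd (a + b)" "a + b \<le> t" for a b
    using mixed_moment_odd[OF that, of b x y] by (simp add: M_def mixed_moment_def)
  note mm = mixed_moment_eqs[OF assms(4,5) u_def[symmetric] M_def[symmetric]]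
  note S = gegenbauer_simps sum_atMost_numeral coeff_pCons_numeral
  note mo = moment_2 moment_4 moment_6 moment_8
  have nz: "n \<noteq> 0" "n + 2 \<noteq> 0" "n + 4 \<noteq> 0" "n + 6 \<noteq> 0"
    using n_pos by auto
  have "j = 0 \<or> j = 1 \<or> j = 2 \<or> j = 3 \<or> j = 4" "a = 0 \<or> a = 1 \<or> a = 2 \<or> a = 3 \<or> a = 4"
    using assms(1,2) by linarith+
  then have "odd (a + j) \<or> j = 0 \<and> a = 0 \<or> j = 1 \<and> a = 1 \<or> j = 2 \<and> a = 0 \<or> j = 2 \<and> a = 2 \<or>
      j = 3 \<and> a = 1 \<or> j = 3 \<and> a = 3 \<or> j = 4 \<and> a = 0 \<or> j = 4 \<and> a = 2 \<or> j = 4 \<and> a = 4"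
    using assms(1) by (elim disjE) simp_all
  then have "coeff (gegenbauer n j) j * (\<Sum>b\<le>j. coeff (gegenbauer n j) b * M a b)
     = (if a = j then poly (gegenbauer n j) u else 0)"
  proof (elim disjE conjE)
    assume o: "odd (a + j)"
    \<comment> \<open>Either \<open>a + b\<close> is odd and the mixed moment vanishes, or
      \<open>j + b\<close> is odd and the polynomial has no term of degree \<open>b\<close>.\<close>
    have "coeff (gegenbauer n j) b * M a b = 0" if "b \<le> j" for b
    proof (cases "odd (a + b)")
      case True
      then show ?thesis using odd[of a b] that assms(1,3) by simp
    next
      case False
      then have "odd (j + b)" using o by presburger
      moreover have "j = 0 \<or> j = 1 \<or> j = 2 \<or> j = 3 \<or> j = 4" "b = 0 \<or> b = 1 \<or> b = 2 \<or> b = 3 \<or> b = 4"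
        using assms(2) that by linarith+
      ultimately have "coeff (gegenbauer n j) b = 0"
        using that by (elim disjE) (simp_all add: S del: One_nat_def)
      then show ?thesis by simp
    qed
    then have "(\<Sum>b\<le>j. coeff (gegenbauer n j) b * M a b) = 0"
      by (intro sum.neutral) auto
    then show ?thesis using o by auto
  next
    assume "j = 0" "a = 0"
    then show ?thesis by (simp add: S mm(1))
  next
    assume "j = 1" "a = 1"
    then show ?thesis using assms(3) nz by (simp add: S mm(3) mo(1) del: One_nat_def)
  next
    assume "j = 2" "a = 0"
    then show ?thesis using assms(3) nz by (simp add: S mm(1,2) mo(1) del: One_nat_def)
  next
    assume "j = 2" "a = 2"
    then show ?thesis using assms(3) nz
      by (simp add: S mm(4,7) mo(1,2) del: One_nat_def)
        (simp add: divide_simps, simp add: algebra_simps power2_eq_square power3_eq_cube power4_eq_xxxx)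
  next
    assume "j = 3" "a = 1"
    then show ?thesis using assms(3) nz
      by (simp add: S mm(3,6) mo(1,2) del: One_nat_def)
        (simp add: divide_simps, simp add: algebra_simps power2_eq_square power3_eq_cube power4_eq_xxxx)
  next
    assume "j = 3" "a = 3"
    \<comment> \<open>The list \<open>mm\<close> only has \<open>M 1 3\<close>, so the two vectors
      are exchanged.\<close>
    then have "M 3 1 = u * moment 4"
      using assms(3) mixed_moment_eqs(6)[OF assms(5,4) _ refl, of u]
      by (simp add: M_def mixed_moment_def u_def inner_commute mult.commute)
    with \<open>j = 3\<close> \<open>a = 3\<close> show ?thesis using assms(3) nz
      by (simp add: S mm(6,9) mo(2,3) del: One_nat_def)
        (simp add: divide_simps, simp add: algebra_simps power2_eq_square power3_eq_cube power4_eq_xxxx)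
  next
    assume "j = 4" "a = 0"
    then show ?thesis using assms(3) nz
      by (simp add: S mm(1,2,5) mo(1,2) del: One_nat_def)
        (simp add: divide_simps, simp add: algebra_simps power2_eq_square power3_eq_cube power4_eq_xxxx)
  next
    assume "j = 4" "a = 2"
    then show ?thesis using assms(3) nz
      by (simp add: S mm(4,7,8) mo(1,2,3) del: One_nat_def)
        (simp add: divide_simps, simp add: algebra_simps power2_eq_square power3_eq_cube power4_eq_xxxx)
  next
    assume "j = 4" "a = 4"
    then have "M 4 0 = moment 4" "M 4 2 = (1 + 4 * u\<^sup>2) / 5 * moment 6"
      using assms(3) mixed_moment_eqs(5,8)[OF assms(5,4) _ refl, of u]
      by (simp_all add: M_def mixed_moment_def u_def inner_commute mult.commute)
    with \<open>j = 4\<close> \<open>a = 4\<close> show ?thesis using assms(3) nz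
      by (simp add: S mm(10) mo(2,3,4) del: One_nat_def)
        (simp add: divide_simps, simp add: algebra_simps power2_eq_square power3_eq_cube power4_eq_xxxx)
  qed
  then show ?thesis
    unfolding exp u_def .
qed

text \<open>The factor of lower degree is expanded into monomials. Only a monomial of degree
  \<open>j\<close> survives, which needs \<open>i = j\<close>; then the leading coefficient
  cancels.\<close>

lemma avg_gegenbauer_le:
  assumes "i \<le> j" "j \<le> 4" "2 * j \<le> t" "x \<bullet> x = 1" "y \<bullet> y = 1"
  shows "avg (\<lambda>z. poly (gegenbauer n i) (x \<bullet> z) * poly (gegenbauer n j) (y \<bullet> z)) =
    (if i = j then poly (gegenbauer n i) (x \<bullet> y) else 0)"
proof -
  let ?G = "gegenbauer n"
  have lead: "coeff (?G j) j \<noteq> 0"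
    using assms(2) n_pos by (rule coeff_gegenbauer_neq_0)
  have "avg (\<lambda>z. poly (?G i) (x \<bullet> z) * poly (?G j) (y \<bullet> z))
      = (\<Sum>a\<le>i. coeff (?G i) a * avg (\<lambda>z. poly (?G j) (y \<bullet> z) * (x \<bullet> z) ^ a))"
    using avg_mult_poly[of "?G i" i "\<lambda>z. poly (?G j) (y \<bullet> z)" x] assms n_pos
    by (simp add: degree_gegenbauer mult.commute)
  also have "\<dots> = (\<Sum>a\<le>i. if a = j then poly (?G j) (x \<bullet> y) else 0)"
  proof (rule sum.cong[OF refl])
    fix a assume "a \<in> {..i}"
    then have "coeff (?G j) j * avg (\<lambda>z. poly (?G j) (y \<bullet> z) * (x \<bullet> z) ^ a) =
      (if a = j then poly (?G j) (x \<bullet> y) else 0)"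
      using avg_monomial_gegenbauer[of a j x y] assms by (simp add: mult.commute)
    moreover have "a = j \<Longrightarrow> i = j" using \<open>a \<in> {..i}\<close> assms(1) by simp
    ultimately show "coeff (?G i) a * avg (\<lambda>z. poly (?G j) (y \<bullet> z) * (x \<bullet> z) ^ a) =
        (if a = j then poly (?G j) (x \<bullet> y) else 0)"
      using lead by auto
  qed
  finally show ?thesis
    using assms(1) by auto
qed

lemma avg_gegenbauer:
  assumes "i \<le> d" "j \<le> d" "d \<le> 4" "2 * d \<le> t" "x \<bullet> x = 1" "y \<bullet> y = 1"
  shows "avg (\<lambda>z. poly (gegenbauer n i) (x \<bullet> z) * poly (gegenbauer n j) (y \<bullet> z)) =
    (if i = j then poly (gegenbauer n i) (x \<bullet> y) else 0)"
proof (cases "i \<le> j")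
  case True
  with avg_gegenbauer_le[of i j x y] assms show ?thesis
    by simp
next
  case False
  with avg_gegenbauer_le[of j i y x] assms show ?thesis
    by (simp add: mult.commute)
qed

end

section \<open>Rational idempotents\<close>

text \<open>Each \<open>gegenbauer n j\<close> has exact degree \<open>j\<close>, so leading terms
  can be removed one degree at a time.\<close>

lemma gegenbauer_expansion:
  assumes "degree p \<le> d" "d \<le> 4" "n > 0"
  obtains u where "p = (\<Sum>j\<le>d. smult (u j) (gegenbauer n j))"
  using assms
proof (induction d arbitrary: p thesis)
  case 0
  then obtain a where "p = [:a:]" by (metis degree_eq_zeroE le_zero_eq)
  then have "p = (\<Sum>j\<le>0. smult a (gegenbauer n j))"
    by (simp add: gegenbauer_simps)
  then show ?case by (rule "0.prems"(1))
next
  case (Suc d)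
  let ?G = "gegenbauer n"
  have deg: "degree (?G (Suc d)) = Suc d"
    using Suc.prems by (simp add: degree_gegenbauer)
  have lead: "coeff (?G (Suc d)) (Suc d) \<noteq> 0"
    using Suc.prems by (intro coeff_gegenbauer_neq_0)
  define c where "c = coeff p (Suc d) / coeff (?G (Suc d)) (Suc d)"
  have "degree (p - smult c (?G (Suc d))) \<le> d"
  proof (rule degree_le, intro allI impI)
    fix i assume "d < i"
    then consider "i = Suc d" | "i > Suc d" by linarith
    then show "coeff (p - smult c (?G (Suc d))) i = 0"
    proof cases
      case 1
      then show ?thesis using lead by (simp add: c_def)
    next
      case 2
      then show ?thesis using Suc.prems(2) deg by (simp add: coeff_eq_0)
    qed
  qed
  then obtain u where u: "p - smult c (?G (Suc d)) = (\<Sum>j\<le>d. smult (u j) (?G j))"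
    using Suc.IH Suc.prems(3,4) by (meson Suc_leD)
  have "p = (\<Sum>j\<le>Suc d. smult ((u(Suc d := c)) j) (?G j))"
    using u by (simp add: algebra_simps)
  then show ?case by (rule Suc.prems(1))
qed

section \<open>The idempotents of a code\<close>

locale sharp_code = isotropic_code C t n
  for C :: "(real ^ 'n) set" and t :: nat and n :: real +
  fixes d :: nat
  assumes d_le: "d \<le> 4" "2 * d \<le> t"
    and card_inner_products: "card (inner_products C) = Suc d"
    and n_gt_2: "n > 2"
begin

definition N :: real where "N = real (card C)"

text \<open>On \<open>C\<close>, the matrices with entries \<open>q j (x \<bullet> y) / N\<close> are the primitive idempotents of the
  association scheme carried by \<open>C\<close>, and \<open>q j 1\<close> is the rank of the \<open>j\<close>-th one.\<close>

definition q :: "nat \<Rightarrow> real \<Rightarrow> real" where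
  "q j a = (if j \<le> d then poly (gegenbauer n j) a
    else (if a = 1 then N else 0) - (\<Sum>i\<le>d. poly (gegenbauer n i) a))"

definition nodes :: "real set" where "nodes = insert 1 (inner_products C)"

lemma N_pos: "N > 0"
  using card_C by (simp add: N_def)

lemma inner_self: "x \<in> C \<Longrightarrow> x \<bullet> x = 1"
  using norm_C by (simp add: norm_eq_1)

lemma inner_eq_1_iff:
  assumes "x \<in> C" "y \<in> C"
  shows "x \<bullet> y = 1 \<longleftrightarrow> x = y"
proof
  assume "x \<bullet> y = 1"
  then have "(x - y) \<bullet> (x - y) = 0"
    using assms by (simp add: inner_diff_left inner_diff_right inner_commute inner_self)
  then show "x = y" by simp
qed (use assms inner_self in auto)

lemma inner_in_nodes: "x \<in> C \<Longrightarrow> y \<in> C \<Longrightarrow> x \<bullet> y \<in> nodes"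
  by (cases "x = y") (auto simp: nodes_def inner_self inner_products_def)

lemma one_notin_inner_products: "1 \<notin> inner_products C"
  using inner_eq_1_iff by (fastforce simp: inner_products_def)

lemma sum_q: "(\<Sum>j\<le>Suc d. q j a) = (if a = 1 then N else 0)"
  by (simp add: q_def)

lemma sum_delta:
  fixes c :: real
  assumes "y \<in> C"
  shows "(\<Sum>z\<in>C. f z * (if y \<bullet> z = 1 then c else 0)) = f y * c"
proof -
  have "(\<Sum>z\<in>C. f z * (if y \<bullet> z = 1 then c else 0)) = (\<Sum>z\<in>C. if y = z then f z * c else 0)"
    using assms by (intro sum.cong refl) (auto simp: inner_eq_1_iff)
  then show ?thesis using finite_C assms by simp
qed

text \<open>These are the relations of orthogonal idempotents. Up to index \<open>d\<close> they are
  \<open>avg_gegenbauer\<close>; the last idempotent is the complement of the others, so its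
  relations follow by subtraction.\<close>

lemma q_orthogonal:
  assumes "i \<le> Suc d" "j \<le> Suc d" "x \<in> C" "y \<in> C"
  shows "(\<Sum>z\<in>C. q i (x \<bullet> z) * q j (y \<bullet> z)) = (if i = j then N * q i (x \<bullet> y) else 0)"
proof -
  have low: "(\<Sum>z\<in>C. q i (x \<bullet> z) * q j (y \<bullet> z)) = (if i = j then N * q i (x \<bullet> y) else 0)"
    if "i \<le> d" "j \<le> d" "x \<in> C" "y \<in> C" for i j x y
  proof -
    have "(\<Sum>z\<in>C. q i (x \<bullet> z) * q j (y \<bullet> z)) =
        N * avg (\<lambda>z. poly (gegenbauer n i) (x \<bullet> z) * poly (gegenbauer n j) (y \<bullet> z))"
      using that N_pos by (simp add: avg_def q_def N_def)
    then show ?thesis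
      using that d_le by (simp add: avg_gegenbauer[of i d j] inner_self q_def)
  qed
  have last: "(\<Sum>z\<in>C. f z * q (Suc d) (y \<bullet> z)) = N * f y - (\<Sum>k\<le>d. \<Sum>z\<in>C. f z * q k (y \<bullet> z))"
    if "y \<in> C" for f y
  proof -
    have "(\<Sum>z\<in>C. f z * q (Suc d) (y \<bullet> z)) =
        (\<Sum>z\<in>C. f z * (if y \<bullet> z = 1 then N else 0)) - (\<Sum>z\<in>C. \<Sum>k\<le>d. f z * q k (y \<bullet> z))"
      by (simp add: q_def right_diff_distrib sum_subtractf sum_distrib_left)
    then show ?thesis
      unfolding sum_delta[OF that] by (subst (asm) sum.swap) (simp add: mult.commute)
  qed
  have mid: "(\<Sum>z\<in>C. q i (x \<bullet> z) * q (Suc d) (y \<bullet> z)) = 0"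
    if "i \<le> d" "x \<in> C" "y \<in> C" for i x y
    unfolding last[OF that(3)] using that by (simp add: low)
  consider "i \<le> d" "j \<le> d" | "i \<le> d" "j = Suc d" | "i = Suc d" "j \<le> d" | "i = Suc d" "j = Suc d"
    using assms(1,2) by linarith
  then show ?thesis
  proof cases
    case 1
    then show ?thesis using low assms by simp
  next
    case 2
    then show ?thesis using mid assms by simp
  next
    case 3
    then show ?thesis using mid[of j y x] assms by (simp add: mult.commute)
  next
    case 4
    have "(\<Sum>z\<in>C. q (Suc d) (x \<bullet> z) * q k (y \<bullet> z)) = 0" if "k \<le> d" for k
      using mid[of k y x] assms that by (simp add: mult.commute)
    then show ?thesis
      using 4 last[OF assms(4), of "\<lambda>z. q (Suc d) (x \<bullet> z)"] by simp
  qed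
qed

text \<open>Up to index \<open>d\<close> the values are explicit. For the last index,
  \<open>N * q (Suc d) 1\<close> is a sum of squares; if it were zero, the nonzero polynomial
  \<open>P\<close> of degree at most \<open>d\<close> would have all \<open>d + 1\<close> inner
  products as roots.\<close>

lemma q_1_pos:
  assumes "j \<le> Suc d"
  shows "q j 1 > 0"
proof (cases "j \<le> d")
  case True
  then have "j \<le> 4" using d_le by simp
  then have "poly (gegenbauer n j) 1 > 0"
    using n_gt_2 by (elim le_4_cases)
      (auto simp: poly_gegenbauer_1 poly_gegenbauer_1[unfolded One_nat_def] power2_eq_square less_1_mult
        del: One_nat_def intro!: mult_pos_pos)
  then show ?thesis using True by (simp add: q_def)
next
  case False
  then have j: "j = Suc d" using assms by simp
  have sq: "N * q (Suc d) 1 = (\<Sum>z\<in>C. (q (Suc d) (x \<bullet> z))\<^sup>2)" if "x \<in> C" for x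
    using q_orthogonal[of "Suc d" "Suc d" x x] that by (simp add: inner_self power2_eq_square)
  obtain x0 where "x0 \<in> C" using C_nonempty by blast
  have "q (Suc d) 1 \<noteq> 0"
  proof
    assume "q (Suc d) 1 = 0"
    then have 0: "q (Suc d) (x \<bullet> z) = 0" if "x \<in> C" "z \<in> C" for x z
      using sq[OF that(1)] that(2) finite_C by (simp add: sum_nonneg_eq_0_iff)
    define P where "P = (\<Sum>i\<le>d. gegenbauer n i)"
    have "coeff P d = (\<Sum>i\<le>d. if i = d then coeff (gegenbauer n d) d else 0)"
      unfolding P_def coeff_sum
      by (intro sum.cong refl) (use d_le n_pos in \<open>auto simp: coeff_eq_0 degree_gegenbauer\<close>)
    then have "P \<noteq> 0"
      using coeff_gegenbauer_neq_0[OF d_le(1) n_pos] by auto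
    have "degree P \<le> d"
      unfolding P_def by (rule degree_sum_le) (use d_le n_pos in \<open>auto simp: degree_gegenbauer\<close>)
    have "inner_products C \<subseteq> {a. poly P a = 0}"
    proof
      fix a assume a: "a \<in> inner_products C"
      then have "q (Suc d) a = 0" "a \<noteq> 1"
        using 0 one_notin_inner_products by (auto simp: inner_products_def)
      then show "a \<in> {a. poly P a = 0}" by (simp add: q_def P_def poly_sum)
    qed
    then have "card (inner_products C) \<le> card {a. poly P a = 0}"
      using \<open>P \<noteq> 0\<close> by (intro card_mono poly_roots_finite)
    also have "\<dots> \<le> degree P" using \<open>P \<noteq> 0\<close> by (rule card_poly_roots_bound)
    finally show False using \<open>degree P \<le> d\<close> card_inner_products by simp
  qed
  moreover have "N * q (Suc d) 1 \<ge> 0"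
    unfolding sq[OF \<open>x0 \<in> C\<close>] by (intro sum_nonneg) simp
  ultimately show ?thesis using N_pos j by (simp add: zero_le_mult_iff)
qed

lemma finite_inner_products: "finite (inner_products C)"
  using card_inner_products card.infinite by fastforce

text \<open>The functions \<open>q j\<close> span all functions on the nodes. For
  \<open>c = 1\<close> this is \<open>sum_q\<close>; otherwise Lagrange interpolation on the
  \<open>d + 1\<close> inner products has degree at most \<open>d\<close>, hence a Gegenbauer
  expansion.\<close>

lemma indicator_expansion:
  assumes "c \<in> nodes"
  obtains w where "\<And>a. a \<in> nodes \<Longrightarrow> (\<Sum>j\<le>Suc d. w j * q j a) = (if a = c then 1 else 0)"
proof (cases "c = 1")
  case True
  have "(\<Sum>j\<le>Suc d. 1 / N * q j a) = (if a = c then 1 else 0)" for a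
    using True N_pos unfolding sum_distrib_left[symmetric] sum_q by simp
  then show ?thesis by (rule that)
next
  case False
  let ?A = "inner_products C"
  have c: "c \<in> ?A" using assms False by (simp add: nodes_def)
  define p where "p = (\<Prod>a\<in>?A - {c}. smult (1 / (c - a)) [:- a, 1:])"
  have "degree p \<le> sum (degree \<circ> (\<lambda>a. smult (1 / (c - a)) [:- a, 1:])) (?A - {c})"
    unfolding p_def by (rule degree_prod_sum_le) (use finite_inner_products in simp)
  also have "\<dots> \<le> (\<Sum>a\<in>?A - {c}. 1)"
    by (rule sum_mono) simp
  also have "\<dots> = d"
    using c card_inner_products finite_inner_products by simp
  finally obtain u where u: "p = (\<Sum>j\<le>d. smult (u j) (gegenbauer n j))"
    using gegenbauer_expansion d_le(1) n_pos by blast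
  have p_at: "poly p a = (if a = c then 1 else 0)" if "a \<in> ?A" for a
    using that finite_inner_products
    by (auto simp: p_def poly_prod intro!: prod.neutral simp flip: diff_divide_distrib)
  \<comment> \<open>The interpolant may be nonzero at 1. By \<open>sum_q\<close>, the constant shift
    of the coefficients subtracts its value there and changes nothing at the other nodes.\<close>
  define w where "w = (\<lambda>j. (if j \<le> d then u j else 0) - poly p 1 / N)"
  show ?thesis
  proof (rule that[of w])
    fix a assume a: "a \<in> nodes"
    have "(\<Sum>j\<le>Suc d. w j * q j a) = (\<Sum>j\<le>Suc d. (if j \<le> d then u j else 0) * q j a)
        - poly p 1 / N * (\<Sum>j\<le>Suc d. q j a)"
      unfolding w_def left_diff_distrib sum_subtractf sum_distrib_left ..
    also have "(\<Sum>j\<le>Suc d. (if j \<le> d then u j else 0) * q j a) = poly p a"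
      by (simp add: u poly_sum q_def)
    finally show "(\<Sum>j\<le>Suc d. w j * q j a) = (if a = c then 1 else 0)"
      unfolding sum_q using a p_at False N_pos one_notin_inner_products by (auto simp: nodes_def)
  qed
qed

section \<open>Dual orthogonality and rational matrices\<close>

definition dual_kernel :: "real \<Rightarrow> real \<Rightarrow> real" where
  "dual_kernel a b = (\<Sum>j\<le>Suc d. q j a * q j b / (N * q j 1))"

text \<open>The kernel reproduces every \<open>q i\<close>, hence every function on the nodes, with respect to the
  counting weights seen from a point of \<open>C\<close>. So it is diagonal with entries the inverse
  valencies.\<close>

lemma dual_kernel_rational:
  assumes "b \<in> nodes" "c \<in> nodes"
  shows "dual_kernel c b \<in> \<rat>"
proof -
  obtain x where x: "x \<in> C" using C_nonempty by blast
  define k where "k = real (card {z \<in> C. x \<bullet> z = c})"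
  have reproduce: "(\<Sum>z\<in>C. q i (x \<bullet> z) * dual_kernel (x \<bullet> z) b) = q i b" if i: "i \<le> Suc d" for i b
  proof -
    have "(\<Sum>z\<in>C. q i (x \<bullet> z) * dual_kernel (x \<bullet> z) b) =
        (\<Sum>j\<le>Suc d. (\<Sum>z\<in>C. q i (x \<bullet> z) * q j (x \<bullet> z)) * (q j b / (N * q j 1)))"
      unfolding dual_kernel_def sum_distrib_left sum_distrib_right
      by (subst sum.swap) (simp add: mult.assoc)
    also have "\<dots> = (\<Sum>j\<le>Suc d. if i = j then q i b else 0)"
    proof (rule sum.cong[OF refl])
      fix j assume "j \<in> {..Suc d}"
      then show "(\<Sum>z\<in>C. q i (x \<bullet> z) * q j (x \<bullet> z)) * (q j b / (N * q j 1)) = (if i = j then q i b else 0)"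
        using q_orthogonal[OF i _ x x, of j] q_1_pos[of j] N_pos x by (simp add: inner_self)
    qed
    also have "\<dots> = q i b" using i by simp
    finally show ?thesis .
  qed
  \<comment> \<open>The indicator of \<open>c\<close> is written as a combination of the
    \<open>q j\<close>, and \<open>reproduce\<close> is applied to each term.\<close>
  have k: "k * dual_kernel c b = (if b = c then 1 else 0)" if "b \<in> nodes" for b
  proof -
    obtain w where w: "\<And>a. a \<in> nodes \<Longrightarrow> (\<Sum>j\<le>Suc d. w j * q j a) = (if a = c then 1 else 0)"
      using indicator_expansion[OF assms(2)] by blast
    have "k * dual_kernel c b = (\<Sum>z\<in>C. if x \<bullet> z = c then dual_kernel c b else 0)"
      using finite_C by (simp add: k_def flip: sum.inter_filter)
    also have "\<dots> = (\<Sum>z\<in>C. (\<Sum>j\<le>Suc d. w j * q j (x \<bullet> z)) * dual_kernel (x \<bullet> z) b)"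
      by (intro sum.cong refl) (use w inner_in_nodes x in auto)
    also have "\<dots> = (\<Sum>j\<le>Suc d. w j * (\<Sum>z\<in>C. q j (x \<bullet> z) * dual_kernel (x \<bullet> z) b))"
      unfolding sum_distrib_left sum_distrib_right by (subst sum.swap) (simp only: mult.assoc)
    also have "\<dots> = (\<Sum>j\<le>Suc d. w j * q j b)"
      by (intro sum.cong refl arg_cong2[of _ _ _ _ "(*)"] reproduce) simp
    finally show ?thesis using w[OF that] by simp
  qed
  \<comment> \<open>The case \<open>b = c\<close> has right side 1, so every node occurs as an inner
    product with the chosen point \<open>x\<close>.\<close>
  have "k \<noteq> 0" using k[OF assms(2)] by auto
  then have "dual_kernel c b = (if b = c then 1 / k else 0)"
    using k[OF assms(1)] by (auto simp: field_simps split: if_splits)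
  then show ?thesis by (simp add: k_def)
qed

text \<open>A symbol \<open>w\<close> stands for the matrix with eigenvalue \<open>w j\<close> on the \<open>j\<close>-th eigenspace.\<close>

definition rational_symbol :: "(nat \<Rightarrow> real) \<Rightarrow> bool" where
  "rational_symbol w \<longleftrightarrow> (\<forall>x\<in>C. \<forall>y\<in>C. (\<Sum>j\<le>Suc d. w j * q j (x \<bullet> y)) \<in> \<rat>)"

lemma N_rational: "N \<in> \<rat>"
  by (simp add: N_def)

text \<open>By \<open>sum_q\<close> this symbol is a rational multiple of the identity
  matrix.\<close>

lemma rational_symbol_const:
  assumes "c \<in> \<rat>"
  shows "rational_symbol (\<lambda>_. c)"
  unfolding rational_symbol_def sum_distrib_left[symmetric] sum_q using assms N_rational by auto

lemma rational_symbol_diff: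
  assumes "rational_symbol v" "rational_symbol w"
  shows "rational_symbol (\<lambda>j. v j - w j)"
  using assms unfolding rational_symbol_def left_diff_distrib sum_subtractf
  by (intro ballI Rats_diff) blast+

text \<open>By \<open>q_orthogonal\<close>, products of symbols correspond to products of matrices,
  and these preserve rational entries.\<close>

lemma rational_symbol_mult:
  assumes "rational_symbol v" "rational_symbol w"
  shows "rational_symbol (\<lambda>j. v j * w j)"
  unfolding rational_symbol_def
proof (intro ballI)
  fix x y assume xy: "x \<in> C" "y \<in> C"
  have "(\<Sum>z\<in>C. (\<Sum>i\<le>Suc d. v i * q i (x \<bullet> z)) * (\<Sum>j\<le>Suc d. w j * q j (y \<bullet> z))) =
      (\<Sum>z\<in>C. \<Sum>i\<le>Suc d. \<Sum>j\<le>Suc d. v i * w j * (q i (x \<bullet> z) * q j (y \<bullet> z)))"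
    by (simp only: sum_product mult_ac)
  also have "\<dots> = (\<Sum>i\<le>Suc d. \<Sum>z\<in>C. \<Sum>j\<le>Suc d. v i * w j * (q i (x \<bullet> z) * q j (y \<bullet> z)))"
    by (rule sum.swap)
  also have "\<dots> = (\<Sum>i\<le>Suc d. \<Sum>j\<le>Suc d. \<Sum>z\<in>C. v i * w j * (q i (x \<bullet> z) * q j (y \<bullet> z)))"
    by (intro sum.cong refl sum.swap)
  also have "\<dots> = (\<Sum>i\<le>Suc d. \<Sum>j\<le>Suc d. if i = j then N * (v i * w i * q i (x \<bullet> y)) else 0)"
    unfolding sum_distrib_left[symmetric]
    by (intro sum.cong refl) (use q_orthogonal xy in simp)
  also have "\<dots> = N * (\<Sum>i\<le>Suc d. v i * w i * q i (x \<bullet> y))"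
    by (simp add: sum_distrib_left del: sum.atMost_Suc)
  finally have "(\<Sum>i\<le>Suc d. v i * w i * q i (x \<bullet> y)) =
      (\<Sum>z\<in>C. (\<Sum>i\<le>Suc d. v i * q i (x \<bullet> z)) * (\<Sum>j\<le>Suc d. w j * q j (y \<bullet> z))) / N"
    using N_pos by (simp del: sum.atMost_Suc)
  also have "\<dots> \<in> \<rat>"
    by (rule Rats_divide, rule Rats_sum, rule Rats_mult)
      (use assms xy N_rational in \<open>unfold rational_symbol_def, blast+\<close>)
  finally show "(\<Sum>i\<le>Suc d. v i * w i * q i (x \<bullet> y)) \<in> \<rat>" .
qed

lemma rational_symbol_prod:
  assumes "finite I" "\<And>i. i \<in> I \<Longrightarrow> rational_symbol (w i)"
  shows "rational_symbol (\<lambda>j. \<Prod>i\<in>I. w i j)"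
  using assms by (induction I rule: finite_induct)
    (simp_all add: rational_symbol_const rational_symbol_mult)

text \<open>Summing the rational values of \<open>dual_kernel\<close> at \<open>x . z\<close> and
  \<open>y . z\<close> over \<open>z\<close> turns each term, by idempotency, into
  \<open>q j (x . y) / q j 1\<close>.\<close>

lemma rational_symbol_inverse_multiplicity: "rational_symbol (\<lambda>j. 1 / q j 1)"
  unfolding rational_symbol_def
proof (intro ballI)
  fix x y assume xy: "x \<in> C" "y \<in> C"
  have "(\<Sum>z\<in>C. dual_kernel (x \<bullet> z) (y \<bullet> z)) =
      (\<Sum>j\<le>Suc d. (\<Sum>z\<in>C. q j (x \<bullet> z) * q j (y \<bullet> z)) / (N * q j 1))"
    unfolding dual_kernel_def sum_divide_distrib by (rule sum.swap)
  also have "\<dots> = (\<Sum>j\<le>Suc d. 1 / q j 1 * q j (x \<bullet> y))"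
    by (intro sum.cong refl) (use q_orthogonal xy N_pos in simp)
  finally show "(\<Sum>j\<le>Suc d. 1 / q j 1 * q j (x \<bullet> y)) \<in> \<rat>"
    using xy by (metis (no_types, lifting) Rats_sum dual_kernel_rational inner_in_nodes)
qed

lemma q_1_rational:
  assumes "j \<le> Suc d"
  shows "q j 1 \<in> \<rat>"
proof -
  have "n \<in> \<rat>" by (simp add: dim)
  have G: "poly (gegenbauer n i) 1 \<in> \<rat>" if "i \<le> d" for i
  proof -
    have "i \<le> 4" using that d_le by simp
    then show ?thesis
      using \<open>n \<in> \<rat>\<close>
      by (elim le_4_cases) (auto simp: poly_gegenbauer_1 poly_gegenbauer_1[unfolded One_nat_def]
          del: One_nat_def intro!: Rats_divide Rats_mult Rats_add Rats_diff Rats_power)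
  qed
  then show ?thesis
    using N_rational by (auto simp: q_def intro!: Rats_diff Rats_sum)
qed

text \<open>Lagrange interpolation in the symbol \<open>1 / q j 1\<close> yields the symbol that is
  1 at \<open>i\<close> and 0 elsewhere. Other multiplicities may coincide with one another, since
  only differences with the \<open>i\<close>-th one are inverted.\<close>

lemma unique_multiplicity_rational:
  assumes i: "i \<le> Suc d" and unique: "\<And>j. j \<le> Suc d \<Longrightarrow> j \<noteq> i \<Longrightarrow> q j 1 \<noteq> q i 1"
    and xy: "x \<in> C" "y \<in> C"
  shows "q i (x \<bullet> y) \<in> \<rat>"
proof -
  define w where "w = (\<lambda>j. \<Prod>k\<in>{..Suc d} - {i}. (1 / q j 1 - 1 / q k 1) * (1 / (1 / q i 1 - 1 / q k 1)))"
  have "rational_symbol w"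
    unfolding w_def
    by (intro rational_symbol_prod rational_symbol_mult rational_symbol_diff rational_symbol_const
        rational_symbol_inverse_multiplicity Rats_divide Rats_diff Rats_1 q_1_rational) (use i in auto)
  then have "(\<Sum>j\<le>Suc d. w j * q j (x \<bullet> y)) \<in> \<rat>"
    using xy by (simp add: rational_symbol_def)
  also have "(\<Sum>j\<le>Suc d. w j * q j (x \<bullet> y)) = (\<Sum>j\<le>Suc d. if j = i then q i (x \<bullet> y) else 0)"
  proof (rule sum.cong[OF refl])
    fix j assume j: "j \<in> {..Suc d}"
    have "1 / q i 1 - 1 / q k 1 \<noteq> 0" if "k \<in> {..Suc d} - {i}" for k
      using unique[of k] that q_1_pos[of k] q_1_pos[OF i] by (auto simp: field_simps)
    then have "w i = 1"
      unfolding w_def by (intro prod.neutral) auto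
    moreover have "w j = 0" if "j \<noteq> i"
      unfolding w_def by (rule prod_zero) (use j that in auto)
    ultimately show "w j * q j (x \<bullet> y) = (if j = i then q i (x \<bullet> y) else 0)" by auto
  qed
  also have "\<dots> = q i (x \<bullet> y)" using i by simp
  finally show ?thesis .
qed

end

section \<open>Irrational inner products\<close>

context isotropic_code
begin

lemma avg_poly:
  assumes "degree p \<le> k" "k \<le> t" "norm x = 1"
  shows "avg (\<lambda>z. poly p (x \<bullet> z)) = (\<Sum>m\<le>k. coeff p m * moment m)"
proof -
  have "avg (\<lambda>z. poly p (x \<bullet> z)) = (\<Sum>m\<le>k. coeff p m * avg (\<lambda>z. (x \<bullet> z) ^ m))"
    using avg_mult_poly[OF assms(1), of "\<lambda>_. 1" x] by simp
  also have "\<dots> = (\<Sum>m\<le>k. coeff p m * moment m)"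
    using assms(2,3) by (intro sum.cong refl) (simp add: avg_inner_power)
  finally show ?thesis .
qed

end

context sharp_code
begin

text \<open>These are dimensions of spaces of harmonic polynomials. Each difference has the factor
  \<open>n - 2\<close>, whence the substitution; in dimension 2 all of them would equal 2.\<close>

lemma gegenbauer_1_strict_mono:
  "n < poly (gegenbauer n 2) 1"
  "poly (gegenbauer n 2) 1 < poly (gegenbauer n 3) 1"
  "poly (gegenbauer n 3) 1 < poly (gegenbauer n 4) 1"
proof -
  define m where "m = n - 2"
  have n: "n = m + 2" and m: "m > 0" using n_gt_2 by (simp_all add: m_def)
  show "n < poly (gegenbauer n 2) 1" "poly (gegenbauer n 2) 1 < poly (gegenbauer n 3) 1"
    "poly (gegenbauer n 3) 1 < poly (gegenbauer n 4) 1"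
    unfolding poly_gegenbauer_1 n using m
    by (simp_all add: field_simps power2_eq_square add_pos_pos)
qed

text \<open>The ranks up to index \<open>d\<close> are distinct, so only the last can collide with
  another. If it is not \<open>n\<close>, then \<open>q 1\<close> and with it \<open>x . y\<close>
  is rational. If it is \<open>n\<close>, the ranks of index 2 and 3 are unique, so
  \<open>q 2\<close> and \<open>q 3\<close> are rational.\<close>

lemma irrational_inner:
  assumes "3 \<le> d" "x \<in> C" "y \<in> C" "x \<bullet> y \<notin> \<rat>"
  shows "q (Suc d) 1 = n" "(x \<bullet> y)\<^sup>2 = 3 / (n + 2)"
proof -
  let ?a = "x \<bullet> y"
  have n_rat: "n \<in> \<rat>" by (simp add: dim)
  have q_low: "q 0 1 = 1" "q 1 1 = n" "q 2 1 = poly (gegenbauer n 2) 1" "q 3 1 = poly (gegenbauer n 3) 1"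
    "4 \<le> d \<Longrightarrow> q 4 1 = poly (gegenbauer n 4) 1"
    using assms(1) by (simp_all add: q_def gegenbauer_simps del: One_nat_def)
  have j_cases: "j = 0 \<or> j = 1 \<or> j = 2 \<or> j = 3 \<or> j = 4 \<and> 4 \<le> d \<or> j = Suc d" if "j \<le> Suc d" for j
    using that d_le(1) assms(1) by linarith
  note mono = gegenbauer_1_strict_mono n_gt_2
  show last: "q (Suc d) 1 = n"
  proof (rule ccontr)
    assume neq: "q (Suc d) 1 \<noteq> n"
    have "q 1 ?a \<in> \<rat>"
    proof (rule unique_multiplicity_rational)
      fix j assume j: "j \<le> Suc d" "j \<noteq> 1"
      then show "q j 1 \<noteq> q 1 1"
        using j_cases[OF j(1)] j(2) neq mono by (elim disjE) (auto simp: q_low simp del: One_nat_def)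
    qed (use assms in auto)
    then have "n * ?a \<in> \<rat>"
      using assms(1) by (simp add: q_def gegenbauer_simps mult.commute del: One_nat_def)
    then have "(n * ?a) / n \<in> \<rat>" using n_rat by (rule Rats_divide)
    then show False using assms(4) n_pos by simp
  qed
  have "q 2 ?a \<in> \<rat>"
  proof (rule unique_multiplicity_rational)
    fix j assume j: "j \<le> Suc d" "j \<noteq> 2"
    then show "q j 1 \<noteq> q 2 1"
      using j_cases[OF j(1)] j(2) last mono by (elim disjE) (auto simp: q_low simp del: One_nat_def)
  qed (use assms in auto)
  moreover have "q 2 ?a = (n + 2) / 2 * (n * ?a\<^sup>2 - 1)"
    using assms(1) by (simp add: q_def gegenbauer_simps power2_eq_square field_simps)
  ultimately have 2: "(n + 2) / 2 * (n * ?a\<^sup>2 - 1) \<in> \<rat>" by simp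
  have "q 3 ?a \<in> \<rat>"
  proof (rule unique_multiplicity_rational)
    fix j assume j: "j \<le> Suc d" "j \<noteq> 3"
    then show "q j 1 \<noteq> q 3 1"
      using j_cases[OF j(1)] j(2) last mono by (elim disjE) (auto simp: q_low simp del: One_nat_def)
  qed (use assms in auto)
  moreover have "q 3 ?a = n * (n + 4) / 6 * ((n + 2) * ?a\<^sup>2 - 3) * ?a"
    using assms(1) by (simp add: q_def gegenbauer_simps power2_eq_square field_simps)
  ultimately have 3: "n * (n + 4) / 6 * ((n + 2) * ?a\<^sup>2 - 3) * ?a \<in> \<rat>" by simp
  \<comment> \<open>The value of \<open>q 2\<close> is solved for the square of
    \<open>?a\<close>.\<close>
  have "((n + 2) / 2 * (n * ?a\<^sup>2 - 1) / ((n + 2) / 2) + 1) / n \<in> \<rat>"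
    by (rule Rats_divide Rats_add 2 n_rat Rats_1 Rats_number_of)+
  then have sq: "?a\<^sup>2 \<in> \<rat>" using n_pos by simp
  show "?a\<^sup>2 = 3 / (n + 2)"
  proof (rule ccontr)
    \<comment> \<open>The value of \<open>q 3\<close> is \<open>k * ?a\<close>, so a nonzero
      rational \<open>k\<close> would make \<open>?a\<close> rational.\<close>
    define k where "k = n * (n + 4) / 6 * ((n + 2) * ?a\<^sup>2 - 3)"
    assume "?a\<^sup>2 \<noteq> 3 / (n + 2)"
    then have "(n + 2) * ?a\<^sup>2 - 3 \<noteq> 0" using n_pos by (simp add: field_simps)
    then have "k \<noteq> 0" using n_pos by (simp add: k_def)
    moreover have "k \<in> \<rat>"
      unfolding k_def using n_rat sq by (intro Rats_mult Rats_divide Rats_diff Rats_add) auto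
    then have "k * ?a / k \<in> \<rat>" using 3 by (intro Rats_divide) (simp_all add: k_def)
    ultimately show False using assms(4) by simp
  qed
qed

text \<open>The inner products with \<open>x\<close> sum to 0. Without \<open>-(x . y)\<close>, all
  irrational terms of the sum would equal \<open>x . y\<close>, making a positive integer multiple
  of it rational.\<close>

lemma minus_in_inner_products:
  assumes "1 \<le> t" "x \<in> C" "y \<in> C" "x \<bullet> y \<notin> \<rat>"
    and irr: "\<And>z. z \<in> C \<Longrightarrow> x \<bullet> z \<notin> \<rat> \<Longrightarrow> (x \<bullet> z)\<^sup>2 = (x \<bullet> y)\<^sup>2"
  shows "- (x \<bullet> y) \<in> inner_products C"
proof (rule ccontr)
  let ?a = "x \<bullet> y"
  assume no: "- ?a \<notin> inner_products C"
  have z: "x \<bullet> z \<in> \<rat> \<or> x \<bullet> z = ?a" if "z \<in> C" for z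
  proof (cases "x \<bullet> z \<in> \<rat>")
    case False
    then have "x \<bullet> z = ?a \<or> x \<bullet> z = - ?a"
      using irr[OF that] by (simp add: power2_eq_iff)
    moreover have "x \<bullet> z \<in> inner_products C"
      using inner_in_nodes[OF assms(2) that] False by (auto simp: nodes_def)
    ultimately show ?thesis using no by auto
  qed simp
  define K where "K = {z \<in> C. x \<bullet> z \<notin> \<rat>}"
  have "finite K" "y \<in> K" using finite_C assms by (auto simp: K_def)
  have "(\<Sum>z\<in>C. x \<bullet> z) = 0"
    using avg_inner_power[of 1 x] moment_odd[of 1] assms(1) card_C by (simp add: avg_def)
  moreover have "(\<Sum>z\<in>C. x \<bullet> z) = (\<Sum>z\<in>C - K. x \<bullet> z) + (\<Sum>z\<in>K. x \<bullet> z)"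
    by (rule sum.subset_diff) (use finite_C in \<open>auto simp: K_def\<close>)
  moreover have "(\<Sum>z\<in>K. x \<bullet> z) = (\<Sum>z\<in>K. ?a)"
    by (rule sum.cong) (use z in \<open>auto simp: K_def\<close>)
  ultimately have "real (card K) * ?a = - (\<Sum>z\<in>C - K. x \<bullet> z)" by simp
  moreover have "(\<Sum>z\<in>C - K. x \<bullet> z) \<in> \<rat>"
    by (rule Rats_sum) (auto simp: K_def)
  ultimately have "real (card K) * ?a / real (card K) \<in> \<rat>"
    by (intro Rats_divide) auto
  moreover have "card K \<noteq> 0" using \<open>finite K\<close> \<open>y \<in> K\<close> by auto
  ultimately show False using assms(4) by simp
qed

section \<open>Quadrature and the two contradictions\<close>

text \<open>The average of \<open>p\<close> at \<open>x . z\<close> over \<open>C\<close> sees only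
  \<open>z = x\<close>, while the design evaluates it through the moments.\<close>

lemma annihilator:
  assumes "x \<in> C" "degree p \<le> k" "k \<le> t" and root: "\<And>a. a \<in> inner_products C \<Longrightarrow> poly p a = 0"
  shows "(\<Sum>m\<le>k. coeff p m * moment m) = poly p 1 / N"
proof -
  have "(\<Sum>z\<in>C. poly p (x \<bullet> z)) = (\<Sum>z\<in>C. if x = z then poly p 1 else 0)"
  proof (rule sum.cong[OF refl])
    fix z assume z: "z \<in> C"
    show "poly p (x \<bullet> z) = (if x = z then poly p 1 else 0)"
    proof (cases "x = z")
      case False
      then have "x \<bullet> z \<in> inner_products C" using assms(1) z by (auto simp: inner_products_def)
      then show ?thesis using False root by simp
    qed (use assms(1) in \<open>simp add: inner_self\<close>)
  qed
  then have "avg (\<lambda>z. poly p (x \<bullet> z)) = poly p 1 / N"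
    using finite_C assms(1) by (simp add: avg_def N_def)
  then show ?thesis
    using avg_poly[OF assms(2,3) norm_C[OF assms(1)]] by simp
qed

lemma inner_products_split:
  assumes "3 \<le> d" "x \<in> C" "y \<in> C" "x \<bullet> y \<notin> \<rat>"
  obtains G where "card G = d - 1" "\<And>a. a \<in> inner_products C \<Longrightarrow> a\<^sup>2 = 3 / (n + 2) \<or> a \<in> G"
proof -
  let ?a = "x \<bullet> y"
  have "?a \<in> inner_products C"
    using inner_in_nodes[OF assms(2,3)] assms(4) by (auto simp: nodes_def)
  moreover have "- ?a \<in> inner_products C"
    using irrational_inner(2)[OF assms(1,2)] assms d_le(2)
    by (intro minus_in_inner_products) auto
  moreover have "?a \<noteq> - ?a" using assms(4) by auto
  ultimately have "card (inner_products C - {?a, - ?a}) = d - 1"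
    using card_inner_products finite_inner_products by (simp add: card_Diff_subset)
  moreover have "a\<^sup>2 = 3 / (n + 2) \<or> a \<in> inner_products C - {?a, - ?a}" if "a \<in> inner_products C" for a
    using that irrational_inner(2)[OF assms] by auto
  ultimately show ?thesis by (rule that)
qed

text \<open>In the test polynomial, the factor \<open>1 - u\<close> removes the contribution of
  \<open>x\<close> itself, and \<open>u\<close> completes \<open>u^2 - b\<close> to a multiple of
  the Gegenbauer polynomial of degree 3. Orthogonality leaves only the leading term of the cofactor,
  so \<open>moment 6 = b * moment 4\<close>.\<close>

lemma rational_4:
  assumes "d = 3" "x \<in> C" "y \<in> C"
  shows "x \<bullet> y \<in> \<rat>"
proof (rule ccontr)
  assume "x \<bullet> y \<notin> \<rat>"
  then obtain G where "card G = d - 1" and G: "\<And>a. a \<in> inner_products C \<Longrightarrow> a\<^sup>2 = 3 / (n + 2) \<or> a \<in> G"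
    using inner_products_split assms by (metis order_refl)
  then obtain g h where gh: "G = {g, h}" using assms(1) by (auto simp: card_2_iff)
  define b where "b = 3 / (n + 2)"
  \<comment> \<open>\<open>p\<close> contains the degree 3 Gegenbauer polynomial as a factor, and the cofactor has degree 3.\<close>
  define p where "p = [:-b, 0, 1:] * [:-g, 1:] * [:-h, 1:] * [:0, 1, -1:]"
  have p: "poly p a = (a\<^sup>2 - b) * (a - g) * (a - h) * (a * (1 - a))" for a
    by (simp add: p_def power2_eq_square algebra_simps)
  have "6 \<le> t" using d_le(2) assms(1) by simp
  have "(\<Sum>m\<le>6. coeff p m * moment m) = poly p 1 / N"
  proof (rule annihilator[OF assms(2) _ \<open>6 \<le> t\<close>])
    fix a assume "a \<in> inner_products C"
    from G[OF this] show "poly p a = 0" by (auto simp: p gh b_def)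
  qed (simp add: p_def)
  moreover have "moment 1 = 0" "moment 3 = 0" "moment 5 = 0"
    using \<open>6 \<le> t\<close> by (simp_all add: moment_odd)
  ultimately have "moment 6 - b * moment 4 = (b * moment 2 - moment 4) * (g * h + g + h)"
    by (simp add: p p_def eval_nat_numeral algebra_simps)
  moreover have "moment 4 = b * moment 2"
    using \<open>6 \<le> t\<close> by (simp add: moment_2 moment_4 b_def)
  ultimately have "15 / (n * (n + 2) * (n + 4)) = 3 / (n + 2) * (3 / (n * (n + 2)))"
    using \<open>6 \<le> t\<close> by (simp add: moment_4 moment_6 b_def)
  moreover have "n \<noteq> 0" "n + 2 \<noteq> 0" "n + 4 \<noteq> 0" using n_gt_2 by simp_all
  \<comment> \<open>The only solution is \<open>n = 1\<close>.\<close>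
  ultimately have "15 * (n + 2) = 9 * (n + 4)"
    by (simp add: divide_simps)
  then show False using n_gt_2 by simp
qed

text \<open>The annihilator is \<open>(u^2 - r) (u^3 + a u^2 + b u + c)\<close>. Testing it against
  \<open>1\<close>, \<open>u\<close>, \<open>u^2\<close>, \<open>u^3\<close> determines
  \<open>a\<close>, \<open>b\<close>, \<open>c\<close> and \<open>N\<close> in terms of
  \<open>n\<close>; the rank equality \<open>q 5 1 = n\<close> gives a second formula for
  \<open>N\<close>.\<close>

lemma rational_5:
  assumes "d = 4" "x \<in> C" "y \<in> C"
  shows "x \<bullet> y \<in> \<rat>"
proof (rule ccontr)
  assume irr: "x \<bullet> y \<notin> \<rat>"
  then obtain G where "card G = d - 1" and G: "\<And>a. a \<in> inner_products C \<Longrightarrow> a\<^sup>2 = 3 / (n + 2) \<or> a \<in> G"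
    using inner_products_split[OF _ assms(2,3)] assms(1) by auto
  then obtain g h k where ghk: "G = {g, h, k}" using assms(1) by (auto simp: card_3_iff)
  define r where "r = 3 / (n + 2)"
  define a where "a = - (g + h + k)"
  define b where "b = g * h + h * k + g * k"
  define c where "c = - (g * h * k)"
  have "8 \<le> t" using d_le(2) assms(1) by simp
  \<comment> \<open>Monomials have value 1 at 1, so all four test equations share the right side
    \<open>P\<close>.\<close>
  define P where "P = (1 - r) * (1 + a + b + c) / N"
  have quad: "(\<Sum>m\<le>8. coeff ([:-r, 0, 1:] * [:c, b, a, 1:] * e) m * moment m) = P * poly e 1"
    if "degree e \<le> 3" for e
  proof -
    define p where "p = [:-r, 0, 1:] * [:c, b, a, 1:]"
    have p: "poly p u = (u\<^sup>2 - r) * ((u - g) * (u - h) * (u - k))" for u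
      by (simp add: p_def a_def b_def c_def power2_eq_square algebra_simps)
    have "poly p 1 / N = P"
      by (simp add: p_def P_def algebra_simps)
    have "degree p \<le> 5" by (simp add: p_def)
    have "(\<Sum>m\<le>8. coeff (p * e) m * moment m) = poly (p * e) 1 / N"
    proof (rule annihilator[OF assms(2) _ \<open>8 \<le> t\<close>])
      show "degree (p * e) \<le> 8"
        using degree_mult_le[of p e] that \<open>degree p \<le> 5\<close> by linarith
      fix u assume "u \<in> inner_products C"
      from G[OF this] show "poly (p * e) u = 0" by (auto simp: p ghk r_def)
    qed
    then show ?thesis
      unfolding p_def[symmetric] \<open>poly p 1 / N = P\<close>[symmetric] by simp
  qed
  \<comment> \<open>This says that \<open>u^3 - r u\<close> is orthogonal to \<open>u\<close>;
    \<open>D\<close> below is its average against \<open>u^3\<close>.\<close>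
  have r: "moment 4 = r * moment 2"
    using \<open>8 \<le> t\<close> n_gt_2 by (simp add: moment_2 moment_4 r_def)
  define D where "D = moment 6 - r * moment 4"
  have odd: "moment 1 = 0" "moment 3 = 0" "moment 5 = 0" "moment 7 = 0"
    using \<open>8 \<le> t\<close> by (simp_all add: moment_odd)
  have e0: "c * (moment 2 - r) = P"
    using quad[of "[:1:]"] odd r by (simp add: eval_nat_numeral moment_0 algebra_simps)
  have e1: "D = P"
    using quad[of "[:0, 1:]"] odd r by (simp add: D_def eval_nat_numeral moment_0 algebra_simps)
  have e2: "a * D = P"
    using quad[of "[:0, 0, 1:]"] odd r by (simp add: D_def eval_nat_numeral moment_0 algebra_simps)
  have e3: "moment 8 - r * moment 6 + b * D = P"
    using quad[of "[:0, 0, 0, 1:]"] odd r by (simp add: D_def eval_nat_numeral moment_0 algebra_simps)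
  have nz: "n \<noteq> 0" "n - 1 \<noteq> 0" "n + 2 \<noteq> 0" "n + 4 \<noteq> 0" "n + 6 \<noteq> 0"
    using n_gt_2 by auto
  have D: "D = 6 * (n - 1) / (n * (n + 2)\<^sup>2 * (n + 4))"
    using \<open>8 \<le> t\<close> nz by (simp add: D_def r_def moment_4 moment_6)
      (simp add: divide_simps, simp add: power2_eq_square algebra_simps)
  then have "D \<noteq> 0" using nz by simp
  then have a: "a = 1" using e1 e2 by simp
  have "moment 8 - r * moment 6 = 10 / (n + 6) * D"
    using \<open>8 \<le> t\<close> nz unfolding D by (simp add: r_def moment_6 moment_8)
      (simp add: divide_simps, simp add: power2_eq_square algebra_simps)
  then have "(10 / (n + 6) + b) * D = 1 * D" using e1 e3 by (simp add: algebra_simps)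
  then have b: "b = (n - 4) / (n + 6)"
    using \<open>D \<noteq> 0\<close> nz unfolding mult_cancel_right by (simp add: field_simps)
  have m2r: "moment 2 - r = - D * (n + 2) * (n + 4) / 3"
    using \<open>8 \<le> t\<close> nz unfolding D by (simp add: r_def moment_2)
      (simp add: divide_simps, simp add: power2_eq_square algebra_simps)
  have "D * (- c * (n + 2) * (n + 4) / 3) = D * 1"
    using e0 e1 unfolding m2r by (simp add: mult_ac)
  then have "c * ((n + 2) * (n + 4)) = - 3"
    using \<open>D \<noteq> 0\<close> unfolding mult_cancel_left by (simp add: field_simps)
  then have c: "c = - 3 / ((n + 2) * (n + 4))"
    using nz by (subst nonzero_eq_divide_eq) simp_all
  have N: "N = (1 - r) * (2 + b + c) / D"
    using e1 N_pos \<open>D \<noteq> 0\<close> by (simp add: P_def a field_simps)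
  have N1: "6 * N * (n + 6) = n * ((n + 2) * (n + 4) * (3 * n + 8) - 3 * (n + 6))"
    unfolding N D r_def b c using nz
    by (simp add: divide_simps) (simp add: power2_eq_square algebra_simps)
  have "q (Suc d) 1 = n"
    using assms irr by (intro irrational_inner(1)) auto
  then have "N = (\<Sum>j\<le>d. poly (gegenbauer n j) 1) + n"
    by (simp add: q_def)
  then have N2: "24 * N = 24 + 48 * n + 12 * ((n + 2) * (n - 1)) + 4 * (n * (n + 4) * (n - 1))
      + n * (n + 6) * (n\<^sup>2 - 1)"
    by (simp add: assms(1) sum_atMost_numeral poly_gegenbauer_1 field_simps del: One_nat_def)
  have eq: "(24 + 48 * n + 12 * ((n + 2) * (n - 1)) + 4 * (n * (n + 4) * (n - 1))
      + n * (n + 6) * (n\<^sup>2 - 1)) * (n + 6) = 4 * n * ((n + 2) * (n + 4) * (3 * n + 8) - 3 * (n + 6))"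
    using N1 unfolding N2[symmetric] by simp
  \<comment> \<open>The left side of \<open>eq\<close> minus the right side is negative at 3 and 4
    and positive from 5 on, so the small dimensions are separated.\<close>
  have "CARD('n) = 3 \<or> CARD('n) = 4 \<or> 5 \<le> CARD('n)"
    using n_gt_2 by (auto simp: dim)
  then consider "n = 3" | "n = 4" | "n \<ge> 5" unfolding dim by force
  then show False
  proof cases
    case 3
    define m where "m = n - 5"
    have m: "m \<ge> 0" and n: "n = m + 5" using 3 by (simp_all add: m_def)
    \<comment> \<open>This is that difference expanded around \<open>n = 5\<close>, where all
      coefficients are positive.\<close>
    have "m ^ 5 + 29 * m ^ 4 + 309 * m ^ 3 + 1435 * m ^ 2 + 2594 * m + 720 = 0"
      using eq unfolding n by (simp add: algebra_simps eval_nat_numeral)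
    moreover have "m ^ 5 + 29 * m ^ 4 + 309 * m ^ 3 + 1435 * m ^ 2 + 2594 * m \<ge> 0"
      using m by simp
    ultimately show False by linarith
  qed (use eq in simp_all)
qed

end

theorem theorem3p1:
  fixes C :: "(real ^ 'n) set" and s t :: nat
  assumes "s \<in> {4, 5}"
    and "CARD('n) > 2"
    and "distance_set s C"
    and "spherical_design t C"
    and "t \<ge> 2 * s - 2"
  shows "\<forall>x\<in>C. \<forall>y\<in>C. x \<bullet> y \<in> \<rat>"
proof -
  have card: "card (inner_products C) = s"
    using assms(3) by (simp add: distance_set_def)
  then have "C \<noteq> {}"
    using assms(1) by (auto simp: inner_products_def)
  \<comment> \<open>With \<open>d = s - 1\<close> the bound on the strength reads
    \<open>2 * d \<le> t\<close>.\<close>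
  interpret sharp_code C t "real CARD('n)" "s - 1"
  proof
    show "finite C" "\<And>z. z \<in> C \<Longrightarrow> norm z = 1"
      using assms(3) by (auto simp: distance_set_def)
  qed (use assms card \<open>C \<noteq> {}\<close> in \<open>auto intro: spherical_design_power_sum\<close>)
  show ?thesis
    using assms(1) rational_4 rational_5 by auto
qed

end
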